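(* (a) $\mathfrak p=\{K\in\mathfrak g:K=K^*\}$ is a Poisson submanifold of $(\mathfrak g_R^*,\{\cdot,\cdot\}_R)$. Hence the equation $\dot K=\frac12[\Pi_{\mathfrak l}K^j,K]$ ($j=1,2,\ldots$) with $K\in\mathfrak p$ is Hamiltonian with respect to the induced Poisson structure on $\mathfrak p$. (b) For the Hamiltonian $H_1(K)=\frac14(K,K)$, the evolution of the kernel $K(x,y;t)$ corresponding to $K$ is given by the integro-differential equation $$\begin{aligned}\dot K(x,y;t)={}&\tfrac12\int_{-\infty}^xK(x,z;t)K(z,y;t)\,dz-\tfrac12\int_y^\infty K(x,z;t)K(z,y;t)\,dz\\&+\tfrac12\int_{-\infty}^xK(z,x;t)K(z,y;t)\,dz-\tfrac12\int_y^\infty K(x,z;t)K(y,z;t)\,dz.\end{aligned}$$ In the special case when $K$ belongs to the Poisson submanifold $\mathfrak p$, the kernel $K(x,y;t)$ is symmetric and this equation reduces to $$\begin{aligned}\dot K(x,y;t)&=\int_{-\infty}^xK(x,z;t)K(z,y;t)\,dz-\int_y^\infty K(x,z;t)K(z,y;t)\,dz\\&=\int_{-\infty}^yK(x,z;t)K(z,y;t)\,dz-\int_x^\infty K(x,z;t)K(z,y;t)\,dz.\end{aligned}$$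
   Context: Let $\mathcal H=L^2(\mathbb R)$ (real-valued functions) and let $\mathfrak g$ be the Lie algebra of Hilbert-Schmidt operators on $\mathcal H$ (integral operators $(A\varphi)(x)=\int_{\mathbb R}A(x,y)\varphi(y)\,dy$ with kernel in $L^2(\mathbb R^2)$), with bracket $[A,B]=A\circ B-B\circ A$ and the non-degenerate ad-invariant pairing $(A,B)=\int_{\mathbb R^2}A(x,y)B(y,x)\,dx\,dy$. Let $\mathfrak l\subset\mathfrak g$ be the Volterra operators $(A\varphi)(x)=\int_{-\infty}^xA(x,y)\varphi(y)\,dy$ (kernel vanishing for $y>x$) and $\mathfrak k=\{B\in\mathfrak g:B^*=-B\}$. Then $\mathfrak g=\mathfrak l\oplus\mathfrak k$ with projections $\Pi_{\mathfrak l},\Pi_{\mathfrak k}$. Put $R=\Pi_{\mathfrak l}-\Pi_{\mathfrak k}$; $[A,B]_R=\frac12([R(A),B]+[A,R(B)])$ is a second Lie bracket on $\mathfrak g$, and $\mathfrak g_R$ denotes $\mathfrak g$ with this bracket. Identify $\mathfrak g_R^*\simeq\mathfrak g$ via the pairing. For $F\in C^\infty(\mathfrak g_R^* )$, $dF(K)\in\mathfrak g$ is defined by $\frac{d}{dt}|_{t=0}F(K+tK')=(dF(K),K')$. The Lie-Poisson bracket is $\{F_1,F_2\}_R(K)=(K,[dF_1(K),dF_2(K)]_R)$; the Hamiltonian vector field $X_H$ of $H$ is the one whose integral curves satisfy $\frac{d}{dt}F(K(t))=\{F,H\}_R(K(t))$ for all $F$. A submanifold is a Poisson submanifold when every Hamiltonian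 vector field $X_F$, $F\in C^\infty(\mathfrak g_R^* )$, is tangent to it at each of its points. The equation $\dot K=\frac12[\Pi_{\mathfrak l}K^j,K]$ is the Hamiltonian equation of $H_j(K)=\frac1{2(j+1)}\mathrm{tr}(K^{j+1})$. *)

theory Defs
  imports "HOL-Analysis.Analysis"
begin

section \<open>Real square-integrable functions modulo null sets\<close>

definition square_integrable :: "('a::euclidean_space \<Rightarrow> real) \<Rightarrow> bool" where
  "square_integrable f \<longleftrightarrow> f \<in> borel_measurable lborel \<and> integrable lborel (\<lambda>x. (f x)\<^sup>2)"

definition l2rel :: "('a::euclidean_space \<Rightarrow> real) \<Rightarrow> ('a \<Rightarrow> real) \<Rightarrow> bool" where
  "l2rel f g \<longleftrightarrow> square_integrable f \<and> square_integrable g \<and> (AE x in lborel. f x = g x)"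

lemma square_integrableD:
  "square_integrable f \<Longrightarrow> f \<in> borel_measurable borel"
  by (simp add: square_integrable_def)

lemma square_integrable_pairD:
  "square_integrable (k :: real \<times> real \<Rightarrow> real) \<Longrightarrow> k \<in> borel_measurable (borel \<Otimes>\<^sub>M borel)"
  by (simp add: square_integrable_def borel_prod)

lemma square_integrable_sq: "square_integrable f \<Longrightarrow> integrable lborel (\<lambda>x. (f x)\<^sup>2)"
  by (simp add: square_integrable_def)

lemma square_integrable_bound:
  assumes "g \<in> borel_measurable borel" "integrable lborel h" "AE x in lborel. (g x)\<^sup>2 \<le> h x"
  shows "square_integrable g"
  unfolding square_integrable_def
proof
  note [measurable] = assms(1)
  show "g \<in> borel_measurable lborel" by simp
  show "integrable lborel (\<lambda>x. (g x)\<^sup>2)"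
    by (rule Bochner_Integration.integrable_bound[OF assms(2)]) (use assms(3) in auto)
qed

lemma square_integrable_mult:
  assumes f: "square_integrable f" and g: "square_integrable g"
  shows "integrable lborel (\<lambda>x. f x * g x)"
proof (rule Bochner_Integration.integrable_bound)
  note [measurable] = f[THEN square_integrableD] g[THEN square_integrableD]
  show "integrable lborel (\<lambda>x. (f x)\<^sup>2 + (g x)\<^sup>2)"
    using f g by (simp add: square_integrable_def)
  show "(\<lambda>x. f x * g x) \<in> borel_measurable lborel" by measurable
  have "\<bar>a * b\<bar> \<le> a\<^sup>2 + b\<^sup>2" for a b :: real
  proof -
    have "2 * (\<bar>a\<bar> * \<bar>b\<bar>) \<le> a\<^sup>2 + b\<^sup>2"
      using sum_squares_bound[of "\<bar>a\<bar>" "\<bar>b\<bar>"] by simp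
    moreover have "0 \<le> \<bar>a\<bar> * \<bar>b\<bar>" by simp
    ultimately show ?thesis unfolding abs_mult by linarith
  qed
  then show "AE x in lborel. norm (f x * g x) \<le> norm ((f x)\<^sup>2 + (g x)\<^sup>2)"
    by (intro always_eventually) (simp add: abs_mult)
qed

lemma square_integrable_add:
  assumes f: "square_integrable f" and g: "square_integrable g"
  shows "square_integrable (\<lambda>x. f x + g x)"
proof (rule square_integrable_bound)
  note [measurable] = f[THEN square_integrableD] g[THEN square_integrableD]
  show "(\<lambda>x. f x + g x) \<in> borel_measurable borel" by measurable
  show "integrable lborel (\<lambda>x. 2 * (f x)\<^sup>2 + 2 * (g x)\<^sup>2)"
    using f g by (simp add: square_integrable_def)
  have "(a + b)\<^sup>2 \<le> 2 * a\<^sup>2 + 2 * b\<^sup>2" for a b :: real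
    using sum_squares_bound[of a b] by (simp add: power2_sum)
  then show "AE x in lborel. (f x + g x)\<^sup>2 \<le> 2 * (f x)\<^sup>2 + 2 * (g x)\<^sup>2"
    by simp
qed

lemma square_integrable_cmult:
  assumes f: "square_integrable f"
  shows "square_integrable (\<lambda>x. c * f x)"
  using f by (auto simp: square_integrable_def power_mult_distrib)

lemma square_integrable_uminus:
  "square_integrable f \<Longrightarrow> square_integrable (\<lambda>x. - f x)"
  using square_integrable_cmult[of f "-1"] by simp

lemma square_integrable_diff:
  "square_integrable f \<Longrightarrow> square_integrable g \<Longrightarrow> square_integrable (\<lambda>x. f x - g x)"
  using square_integrable_add[of f "\<lambda>x. - g x"] square_integrable_uminus[of g] by simp

lemma square_integrable_zero: "square_integrable (\<lambda>x. 0)"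
  by (simp add: square_integrable_def)

lemma part_equivp_l2rel: "part_equivp (l2rel :: ('a::euclidean_space \<Rightarrow> real) \<Rightarrow> _)"
proof (rule part_equivpI)
  show "\<exists>x::'a \<Rightarrow> real. l2rel x x"
    by (rule exI[of _ "\<lambda>x. 0"]) (simp add: l2rel_def square_integrable_zero)
  show "symp (l2rel :: ('a \<Rightarrow> real) \<Rightarrow> _)"
    by (auto simp: symp_def l2rel_def eq_commute)
  show "transp (l2rel :: ('a \<Rightarrow> real) \<Rightarrow> _)"
  proof (rule transpI)
    fix x y z :: "'a \<Rightarrow> real" assume a: "l2rel x y" "l2rel y z"
    have "AE p in lborel. x p = z p"
      using a unfolding l2rel_def by (auto elim: eventually_elim2)
    then show "l2rel x z" using a by (simp add: l2rel_def)
  qed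
qed

quotient_type (overloaded) 'a l2 = "'a::euclidean_space \<Rightarrow> real" / partial: l2rel
  by (rule part_equivp_l2rel)

instantiation l2 :: (euclidean_space) real_inner
begin

lift_definition zero_l2 :: "'a l2" is "\<lambda>x. 0"
  by (simp add: l2rel_def square_integrable_zero)

lift_definition plus_l2 :: "'a l2 \<Rightarrow> 'a l2 \<Rightarrow> 'a l2" is "\<lambda>f g x. f x + g x"
  unfolding l2rel_def by (auto intro: square_integrable_add elim: eventually_elim2)

lift_definition uminus_l2 :: "'a l2 \<Rightarrow> 'a l2" is "\<lambda>f x. - f x"
  unfolding l2rel_def by (auto intro: square_integrable_uminus)

lift_definition minus_l2 :: "'a l2 \<Rightarrow> 'a l2 \<Rightarrow> 'a l2" is "\<lambda>f g x. f x - g x"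
  unfolding l2rel_def by (auto intro: square_integrable_diff elim: eventually_elim2)

lift_definition scaleR_l2 :: "real \<Rightarrow> 'a l2 \<Rightarrow> 'a l2" is "\<lambda>c f x. c * f x"
  unfolding l2rel_def by (auto intro: square_integrable_cmult elim: eventually_mono)

lift_definition inner_l2 :: "'a l2 \<Rightarrow> 'a l2 \<Rightarrow> real" is "\<lambda>f g. \<integral>x. f x * g x \<partial>lborel"
proof -
  fix f f' g g' :: "'a \<Rightarrow> real"
  assume a: "l2rel f f'" "l2rel g g'"
  then have [measurable]: "f \<in> borel_measurable borel" "f' \<in> borel_measurable borel"
    "g \<in> borel_measurable borel" "g' \<in> borel_measurable borel"
    by (auto simp: l2rel_def square_integrableD)
  show "(\<integral>x. f x * g x \<partial>lborel) = (\<integral>x. f' x * g' x \<partial>lborel)"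
    using a by (intro integral_cong_AE) (auto simp: l2rel_def elim: eventually_elim2)
qed

definition norm_l2 :: "'a l2 \<Rightarrow> real" where "norm_l2 f = sqrt (inner f f)"
definition dist_l2 :: "'a l2 \<Rightarrow> 'a l2 \<Rightarrow> real" where "dist_l2 f g = norm (f - g)"
definition sgn_l2 :: "'a l2 \<Rightarrow> 'a l2" where "sgn_l2 f = scaleR (inverse (norm f)) f"
definition uniformity_l2 :: "('a l2 \<times> 'a l2) filter" where
  "uniformity_l2 = (INF e\<in>{0<..}. principal {(x, y). dist x y < e})"
definition open_l2 :: "'a l2 set \<Rightarrow> bool" where
  "open_l2 U \<longleftrightarrow> (\<forall>x\<in>U. \<forall>\<^sub>F (x', y) in uniformity. x' = x \<longrightarrow> y \<in> U)"

instance
proof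
  fix a b c :: "'a l2" and r s :: real
  show "a + b + c = a + (b + c)"
    by transfer (auto simp: l2rel_def add.assoc intro!: square_integrable_add)
  show "a + b = b + a"
    by transfer (auto simp: l2rel_def add.commute intro!: square_integrable_add)
  show "0 + a = a"
    by transfer (auto simp: l2rel_def)
  show "- a + a = 0"
    by transfer (auto simp: l2rel_def intro!: square_integrable_zero)
  show "a - b = a + - b"
    by transfer (auto simp: l2rel_def intro!: square_integrable_diff)
  show "r *\<^sub>R (a + b) = r *\<^sub>R a + r *\<^sub>R b"
    by transfer (auto simp: l2rel_def algebra_simps
        intro!: square_integrable_add square_integrable_cmult)
  show "(r + s) *\<^sub>R a = r *\<^sub>R a + s *\<^sub>R a"
    by transfer (auto simp: l2rel_def algebra_simps
        intro!: square_integrable_add square_integrable_cmult)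
  show "r *\<^sub>R s *\<^sub>R a = (r * s) *\<^sub>R a"
    by transfer (auto simp: l2rel_def algebra_simps intro!: square_integrable_cmult)
  show "1 *\<^sub>R a = a"
    by transfer (auto simp: l2rel_def)
  show "inner a b = inner b a"
    by transfer (simp add: mult.commute)
  show "inner (a + b) c = inner a c + inner b c"
    by transfer (simp add: l2rel_def distrib_right square_integrable_mult)
  show "inner (r *\<^sub>R a) b = r * inner a b"
    by transfer (simp add: l2rel_def mult.assoc)
  show "0 \<le> inner a a"
    by transfer simp
  show "inner a a = 0 \<longleftrightarrow> a = 0"
  proof (transfer, safe)
    fix f :: "'a \<Rightarrow> real"
    assume f: "l2rel f f" and "(\<integral>x. f x * f x \<partial>lborel) = 0"
    then have "AE x in lborel. (f x)\<^sup>2 = 0"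
      by (subst (asm) integral_nonneg_eq_0_iff_AE)
        (auto simp: l2rel_def square_integrable_mult)
    then show "l2rel f (\<lambda>x. 0)"
      using f by (simp add: l2rel_def square_integrable_zero)
  next
    fix f :: "'a \<Rightarrow> real"
    assume "l2rel f (\<lambda>x. 0)"
    then have "AE x in lborel. f x * f x = 0"
      by (auto simp: l2rel_def)
    then show "(\<integral>x. f x * f x \<partial>lborel) = 0"
      by (rule integral_eq_zero_AE)
  qed
qed (auto simp: norm_l2_def dist_l2_def sgn_l2_def uniformity_l2_def open_l2_def)

end

text \<open>\<open>k\<close> is one of the almost everywhere equal functions making up \<open>A\<close>.\<close>

definition represents :: "('a::euclidean_space \<Rightarrow> real) \<Rightarrow> 'a l2 \<Rightarrow> bool" where
  "represents k A \<longleftrightarrow> square_integrable k \<and> abs_l2 k = A"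

lemma represents_rep: "represents (rep_l2 A) A"
  using Quotient3_l2 Quotient3_rel_rep[OF Quotient3_l2]
  by (metis Quotient3_abs_rep l2rel_def represents_def)

lemma integral_mult_square_le:
  assumes "square_integrable f" "square_integrable g"
  shows "(\<integral>x. f x * g x \<partial>lborel)\<^sup>2 \<le> (\<integral>x. (f x)\<^sup>2 \<partial>lborel) * (\<integral>x. (g x)\<^sup>2 \<partial>lborel)"
proof -
  have r: "l2rel f f" "l2rel g g" using assms by (auto simp: l2rel_def)
  have "inner (abs_l2 f) (abs_l2 g) = (\<integral>x. f x * g x \<partial>lborel)"
    "inner (abs_l2 f) (abs_l2 f) = (\<integral>x. (f x)\<^sup>2 \<partial>lborel)"
    "inner (abs_l2 g) (abs_l2 g) = (\<integral>x. (g x)\<^sup>2 \<partial>lborel)"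
    using r by (simp_all add: inner_l2.abs_eq power2_eq_square)
  then show ?thesis using Cauchy_Schwarz_ineq[of "abs_l2 f" "abs_l2 g"] by metis
qed


section \<open>Hilbert-Schmidt operators on L2(R)\<close>

text \<open>A Hilbert-Schmidt operator is represented by the class of its kernel, so that the norm of
  \<open>hs\<close> is the Hilbert-Schmidt norm; \<open>hs_apply\<close> is the operator itself.\<close>

type_synonym hs = "(real \<times> real) l2"

lemma AE_fst:
  assumes "AE x in lborel. P (x::real)"
  shows "AE (x, y) in (lborel :: (real \<times> real) measure). P x"
proof -
  obtain N where N: "{x. \<not> P x} \<subseteq> N" "emeasure lborel N = 0" "N \<in> sets lborel"
    using AE_E[OF assms] by auto
  have "emeasure (lborel \<Otimes>\<^sub>M lborel) (N \<times> (UNIV :: real set)) = 0"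
    using N by (subst lborel.emeasure_pair_measure_Times) auto
  then have "N \<times> (UNIV :: real set) \<in> null_sets (lborel \<Otimes>\<^sub>M lborel)"
    using N(3) by (intro null_setsI) auto
  then have "N \<times> (UNIV :: real set) \<in> null_sets lborel"
    by (simp add: lborel_prod)
  then show ?thesis
    by (rule AE_I') (use N(1) in auto)
qed

lemma AE_swap:
  assumes "AE p in (lborel :: (real \<times> real) measure). P p"
  shows "AE (x, y) in (lborel :: (real \<times> real) measure). P (y, x)"
proof -
  obtain N where N: "{p. \<not> P p} \<subseteq> N" "emeasure lborel N = 0" "N \<in> sets lborel"
    using AE_E[OF assms] by auto
  have m: "(\<lambda>(x, y). (y, x)) \<in> ((lborel :: real measure) \<Otimes>\<^sub>M (lborel :: real measure)) \<rightarrow>\<^sub>M (lborel \<Otimes>\<^sub>M (lborel :: real measure))"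
    by measurable
  have "AE p in distr (lborel \<Otimes>\<^sub>M lborel) (lborel \<Otimes>\<^sub>M lborel) (\<lambda>(x, y). (y, x)). p \<notin> N"
    unfolding lborel_pair.distr_pair_swap[symmetric]
    using N by (simp add: lborel_prod AE_not_in null_setsI)
  then have "AE p in lborel \<Otimes>\<^sub>M lborel. (case p of (x, y) \<Rightarrow> (y, x)) \<notin> N"
    using N(3) borel_comp[of N] by (subst (asm) AE_distr_iff[OF m])
      (auto simp: borel_prod[symmetric] space_pair_measure Compl_eq[symmetric])
  then have "AE p in lborel. (case p of (x, y) \<Rightarrow> (y, x)) \<notin> N"
    unfolding lborel_prod .
  then show ?thesis
    by eventually_elim (use N(1) in auto)
qed

lemma AE_snd:
  assumes "AE x in lborel. P (x::real)"
  shows "AE (x, y) in (lborel :: (real \<times> real) measure). P y"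
  using AE_swap[OF AE_fst[OF assms]] by (simp add: case_prod_unfold)

lemma AE_section_fst:
  assumes "AE p in (lborel :: (real \<times> real) measure). P p"
  shows "AE x in lborel. AE y in lborel. P (x, y)"
  using assms unfolding lborel_prod[symmetric] by (rule lborel_pair.AE_pair)

lemma AE_section_snd:
  assumes "AE p in (lborel :: (real \<times> real) measure). P p"
  shows "AE y in lborel. AE x in lborel. P (x, y)"
  using AE_section_fst[OF AE_swap[OF assms]] by simp

lemma square_integrable_swap:
  assumes k: "square_integrable (k :: real \<times> real \<Rightarrow> real)"
  shows "square_integrable (\<lambda>(x, y). k (y, x))"
proof -
  note [measurable] = k[THEN square_integrable_pairD]
  have "integrable (lborel \<Otimes>\<^sub>M lborel) (\<lambda>p. (k p)\<^sup>2)"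
    using k by (simp add: square_integrable_def lborel_prod)
  from lborel_pair.integrable_product_swap[OF this]
  have "integrable lborel (\<lambda>(x, y). (k (y, x))\<^sup>2)"
    by (simp add: lborel_prod)
  moreover have "(\<lambda>(x, y). k (y, x)) \<in> borel_measurable borel"
    unfolding borel_prod[symmetric] by measurable
  ultimately show ?thesis
    by (simp add: square_integrable_def case_prod_unfold)
qed

lemma square_integrable_section_fst:
  assumes k: "square_integrable (k :: real \<times> real \<Rightarrow> real)"
  shows "AE x in lborel. square_integrable (\<lambda>y. k (x, y))"
    and "integrable lborel (\<lambda>x. \<integral>y. (k (x, y))\<^sup>2 \<partial>lborel)"
proof -
  note [measurable] = k[THEN square_integrable_pairD]
  have i: "integrable (lborel \<Otimes>\<^sub>M lborel) (\<lambda>p. (k p)\<^sup>2)"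
    using k by (simp add: square_integrable_def lborel_prod)
  have "AE x in lborel. integrable lborel (\<lambda>y. (k (x, y))\<^sup>2)"
    using lborel_pair.AE_integrable_fst'[OF i] by simp
  then show "AE x in lborel. square_integrable (\<lambda>y. k (x, y))"
    by eventually_elim (simp add: square_integrable_def)
  show "integrable lborel (\<lambda>x. \<integral>y. (k (x, y))\<^sup>2 \<partial>lborel)"
    using lborel_pair.integrable_fst'[OF i] by simp
qed

lemma square_integrable_section_snd:
  assumes k: "square_integrable (k :: real \<times> real \<Rightarrow> real)"
  shows "AE y in lborel. square_integrable (\<lambda>x. k (x, y))"
    and "integrable lborel (\<lambda>y. \<integral>x. (k (x, y))\<^sup>2 \<partial>lborel)"
  using square_integrable_section_fst[OF square_integrable_swap[OF k]] by simp_all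

lemma square_integrable_apply:
  assumes k: "square_integrable (k :: real \<times> real \<Rightarrow> real)" and f: "square_integrable f"
  shows "square_integrable (\<lambda>x. \<integral>y. k (x, y) * f y \<partial>lborel)"
proof (rule square_integrable_bound)
  note [measurable] = k[THEN square_integrable_pairD] f[THEN square_integrableD]
  show "(\<lambda>x. \<integral>y. k (x, y) * f y \<partial>lborel) \<in> borel_measurable borel"
    by measurable
  show "integrable lborel (\<lambda>x. (\<integral>y. (k (x, y))\<^sup>2 \<partial>lborel) * (\<integral>y. (f y)\<^sup>2 \<partial>lborel))"
    using square_integrable_section_fst(2)[OF k] by simp
  show "AE x in lborel. (\<integral>y. k (x, y) * f y \<partial>lborel)\<^sup>2
      \<le> (\<integral>y. (k (x, y))\<^sup>2 \<partial>lborel) * (\<integral>y. (f y)\<^sup>2 \<partial>lborel)"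
    using square_integrable_section_fst(1)[OF k]
    by eventually_elim (rule integral_mult_square_le[OF _ f])
qed

lift_definition hs_apply :: "hs \<Rightarrow> real l2 \<Rightarrow> real l2" is
  "\<lambda>k f x. \<integral>y. k (x, y) * f y \<partial>lborel"
proof -
  fix k k' :: "real \<times> real \<Rightarrow> real" and f f' :: "real \<Rightarrow> real"
  assume a: "l2rel k k'" "l2rel f f'"
  then have s: "square_integrable k" "square_integrable k'" "square_integrable f" "square_integrable f'"
    by (auto simp: l2rel_def)
  note [measurable] = s(1,2)[THEN square_integrable_pairD] s(3,4)[THEN square_integrableD]
  have "AE x in lborel. AE y in lborel. k (x, y) = k' (x, y)"
    using a(1) by (intro AE_section_fst) (simp add: l2rel_def)
  then have "AE x in lborel. (\<integral>y. k (x, y) * f y \<partial>lborel) = (\<integral>y. k' (x, y) * f' y \<partial>lborel)"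
  proof eventually_elim
    case (elim x)
    show ?case
      using elim a(2) by (intro integral_cong_AE) (auto simp: l2rel_def elim: eventually_elim2)
  qed
  then show "l2rel (\<lambda>x. \<integral>y. k (x, y) * f y \<partial>lborel) (\<lambda>x. \<integral>y. k' (x, y) * f' y \<partial>lborel)"
    using s by (simp add: l2rel_def square_integrable_apply)
qed

lemma square_integrable_comp:
  assumes a: "square_integrable (a :: real \<times> real \<Rightarrow> real)"
    and b: "square_integrable (b :: real \<times> real \<Rightarrow> real)"
  shows "square_integrable (\<lambda>(x, y). \<integral>z. a (x, z) * b (z, y) \<partial>lborel)"
proof (rule square_integrable_bound)
  note [measurable] = a[THEN square_integrable_pairD] b[THEN square_integrable_pairD]
  show "(\<lambda>(x, y). \<integral>z. a (x, z) * b (z, y) \<partial>lborel) \<in> borel_measurable borel"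
    unfolding borel_prod[symmetric] by measurable
  let ?A = "\<lambda>x. \<integral>z. (a (x, z))\<^sup>2 \<partial>lborel" and ?B = "\<lambda>y. \<integral>z. (b (z, y))\<^sup>2 \<partial>lborel"
  have A: "integrable lborel ?A" and B: "integrable lborel ?B"
    using square_integrable_section_fst(2)[OF a] square_integrable_section_snd(2)[OF b] by auto
  have "integrable (lborel \<Otimes>\<^sub>M lborel) (\<lambda>p. ?A (fst p) * ?B (snd p))"
  proof (rule lborel_pair.Fubini_integrable)
    show "(\<lambda>p. ?A (fst p) * ?B (snd p)) \<in> borel_measurable (lborel \<Otimes>\<^sub>M lborel)"
      by measurable
    show "integrable lborel (\<lambda>x. \<integral>y. norm (?A (fst (x, y)) * ?B (snd (x, y))) \<partial>lborel)"
      using A by (simp add: abs_mult)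
    show "AE x in lborel. integrable lborel (\<lambda>y. ?A (fst (x, y)) * ?B (snd (x, y)))"
      using B by simp
  qed
  then show "integrable lborel (\<lambda>p. ?A (fst p) * ?B (snd p))"
    by (simp add: lborel_prod)
  have "AE p in (lborel :: (real \<times> real) measure). square_integrable (\<lambda>z. a (fst p, z))"
    using AE_fst[OF square_integrable_section_fst(1)[OF a]] by (simp add: case_prod_unfold)
  moreover have "AE p in (lborel :: (real \<times> real) measure). square_integrable (\<lambda>z. b (z, snd p))"
    using AE_snd[OF square_integrable_section_snd(1)[OF b]] by (simp add: case_prod_unfold)
  ultimately show "AE p in lborel. (case p of (x, y) \<Rightarrow> \<integral>z. a (x, z) * b (z, y) \<partial>lborel)\<^sup>2
      \<le> ?A (fst p) * ?B (snd p)"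
    by eventually_elim (use integral_mult_square_le in \<open>auto simp: case_prod_unfold\<close>)
qed

lift_definition hs_comp :: "hs \<Rightarrow> hs \<Rightarrow> hs" (infixl "\<odot>" 70) is
  "\<lambda>a b (x, y). \<integral>z. a (x, z) * b (z, y) \<partial>lborel"
proof -
  fix a a' b b' :: "real \<times> real \<Rightarrow> real"
  assume r: "l2rel a a'" "l2rel b b'"
  then have s: "square_integrable a" "square_integrable a'" "square_integrable b" "square_integrable b'"
    by (auto simp: l2rel_def)
  note [measurable] = s[THEN square_integrable_pairD]
  have "AE x in lborel. AE z in lborel. a (x, z) = a' (x, z)"
    using r by (intro AE_section_fst) (simp add: l2rel_def)
  from AE_fst[OF this]
  have 1: "AE p in (lborel :: (real \<times> real) measure). AE z in lborel. a (fst p, z) = a' (fst p, z)"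
    by (simp add: case_prod_unfold)
  have "AE y in lborel. AE z in lborel. b (z, y) = b' (z, y)"
    using r by (intro AE_section_snd) (simp add: l2rel_def)
  from AE_snd[OF this]
  have 2: "AE p in (lborel :: (real \<times> real) measure). AE z in lborel. b (z, snd p) = b' (z, snd p)"
    by (simp add: case_prod_unfold)
  from 1 2 have "AE p in lborel. (\<integral>z. a (fst p, z) * b (z, snd p) \<partial>lborel)
      = (\<integral>z. a' (fst p, z) * b' (z, snd p) \<partial>lborel)"
  proof eventually_elim
    case (elim p)
    then show ?case
      by (intro integral_cong_AE) (auto elim: eventually_elim2)
  qed
  then show "l2rel (\<lambda>(x, y). \<integral>z. a (x, z) * b (z, y) \<partial>lborel)
      (\<lambda>(x, y). \<integral>z. a' (x, z) * b' (z, y) \<partial>lborel)"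
    using s square_integrable_comp[of a b] square_integrable_comp[of a' b']
    by (simp add: l2rel_def case_prod_unfold)
qed

lemma hs_apply_comp: "hs_apply (A \<odot> B) f = hs_apply A (hs_apply B f)"
proof (transfer)
  fix a b :: "real \<times> real \<Rightarrow> real" and f :: "real \<Rightarrow> real"
  assume "l2rel a a" "l2rel b b" "l2rel f f"
  then have s: "square_integrable a" "square_integrable b" "square_integrable f"
    by (auto simp: l2rel_def)
  note [measurable] = s(1,2)[THEN square_integrable_pairD] s(3)[THEN square_integrableD]
  let ?F = "\<lambda>x. \<integral>y. (\<integral>z. a (x, z) * b (z, y) \<partial>lborel) * f y \<partial>lborel"
  let ?G = "\<lambda>x. \<integral>z. a (x, z) * (\<integral>y. b (z, y) * f y \<partial>lborel) \<partial>lborel"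
  have abs: "square_integrable (\<lambda>p. \<bar>b p\<bar>)" "square_integrable (\<lambda>p. \<bar>f p\<bar>)"
    using s by (auto simp: square_integrable_def)
  have bf: "square_integrable (\<lambda>z. \<integral>y. \<bar>b (z, y)\<bar> * \<bar>f y\<bar> \<partial>lborel)"
    using square_integrable_apply[OF abs] .
  have sec: "AE z in lborel. integrable lborel (\<lambda>y. b (z, y) * f y)"
    using square_integrable_section_fst(1)[OF s(2)]
    by eventually_elim (rule square_integrable_mult[OF _ s(3)])
  have "AE x in lborel. ?F x = ?G x"
    using square_integrable_section_fst(1)[OF s(1)]
  proof eventually_elim
    case (elim x)
        have "integrable lborel (\<lambda>z. \<bar>a (x, z)\<bar> * (\<integral>y. \<bar>b (z, y)\<bar> * \<bar>f y\<bar> \<partial>lborel))"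
      using elim bf by (intro square_integrable_mult) (auto simp: square_integrable_def)
    then have "integrable (lborel \<Otimes>\<^sub>M lborel) (\<lambda>(z, y). a (x, z) * (b (z, y) * f y))"
      using sec by (intro lborel_pair.Fubini_integrable) (auto simp: abs_mult elim: eventually_mono)
    then have "(\<integral>y. (\<integral>z. a (x, z) * (b (z, y) * f y) \<partial>lborel) \<partial>lborel)
        = (\<integral>z. (\<integral>y. a (x, z) * (b (z, y) * f y) \<partial>lborel) \<partial>lborel)"
      by (rule lborel_pair.Fubini_integral)
    then show ?case
      by (simp add: mult.assoc flip: integral_mult_left_zero)
  qed
  then show "l2rel (\<lambda>x. \<integral>y. (case (x, y) of (x, y) \<Rightarrow> \<integral>z. a (x, z) * b (z, y) \<partial>lborel) * f y \<partial>lborel) ?G"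
    using s square_integrable_apply[OF square_integrable_comp[OF s(1,2)] s(3)]
      square_integrable_apply[OF s(1) square_integrable_apply[OF s(2,3)]]
    by (simp add: l2rel_def)
qed


definition hs_power :: "hs \<Rightarrow> nat \<Rightarrow> hs" where \<comment> \<open>only meaningful for exponents \<open>\<ge> 1\<close>: the identity is not Hilbert-Schmidt\<close>
  "hs_power A n = (((\<odot>) A) ^^ (n - 1)) A"

definition lie :: "hs \<Rightarrow> hs \<Rightarrow> hs" where
  "lie A B = A \<odot> B - B \<odot> A"

lift_definition hs_pairing :: "hs \<Rightarrow> hs \<Rightarrow> real" is
  "\<lambda>a b. \<integral>(x, y). a (x, y) * b (y, x) \<partial>lborel"
proof -
  fix a a' b b' :: "real \<times> real \<Rightarrow> real"
  assume r: "l2rel a a'" "l2rel b b'"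
  then have s: "square_integrable a" "square_integrable a'" "square_integrable b" "square_integrable b'"
    by (auto simp: l2rel_def)
  note [measurable] = s[THEN square_integrable_pairD]
  have "AE (x, y) in (lborel :: (real \<times> real) measure). b (y, x) = b' (y, x)"
    using r by (intro AE_swap) (simp add: l2rel_def)
  moreover have "AE p in lborel. a p = a' p"
    using r by (simp add: l2rel_def)
  ultimately have "AE p in lborel. (case p of (x, y) \<Rightarrow> a (x, y) * b (y, x))
      = (case p of (x, y) \<Rightarrow> a' (x, y) * b' (y, x))"
    by eventually_elim auto
  then show "(\<integral>(x, y). a (x, y) * b (y, x) \<partial>lborel) = (\<integral>(x, y). a' (x, y) * b' (y, x) \<partial>lborel)"
    by (intro integral_cong_AE) (simp_all add: borel_prod[symmetric])
qed

definition is_adjoint :: "hs \<Rightarrow> hs \<Rightarrow> bool" where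
  "is_adjoint A B \<longleftrightarrow> (\<forall>f g. inner (hs_apply A f) g = inner f (hs_apply B g))"

definition volterra_ops :: "hs set" where
  "volterra_ops = {A. \<exists>k. represents k A \<and> (\<forall>x y. x < y \<longrightarrow> k (x, y) = 0)}"

definition skew_ops :: "hs set" where
  "skew_ops = {B. is_adjoint B (- B)}"

definition selfadjoint_ops :: "hs set" where
  "selfadjoint_ops = {K. is_adjoint K K}"

text \<open>The projections along the direct sum decomposition \<open>volterra_ops \<oplus> skew_ops\<close>.\<close>

definition proj_volterra :: "hs \<Rightarrow> hs" where
  "proj_volterra A = (THE L. L \<in> volterra_ops \<and> A - L \<in> skew_ops)"

definition proj_skew :: "hs \<Rightarrow> hs" where
  "proj_skew A = (THE B. B \<in> skew_ops \<and> A - B \<in> volterra_ops)"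

definition r_op :: "hs \<Rightarrow> hs" where
  "r_op A = proj_volterra A - proj_skew A"

definition lie_R :: "hs \<Rightarrow> hs \<Rightarrow> hs" where
  "lie_R A B = (1/2) *\<^sub>R (lie (r_op A) B + lie A (r_op B))"

definition orthonormal_basis :: "'a::real_inner set \<Rightarrow> bool" where
  "orthonormal_basis E \<longleftrightarrow> (\<forall>e\<in>E. norm e = 1) \<and> pairwise orthogonal E \<and> closure (span E) = UNIV"

text \<open>Trace of a trace class operator, such as a product of two Hilbert-Schmidt operators: the
  common value of the sum of diagonal entries over every orthonormal basis of L2(R).\<close>

definition hs_trace :: "hs \<Rightarrow> real" where
  "hs_trace A = (THE s. \<forall>E. orthonormal_basis E \<longrightarrow> ((\<lambda>e. inner e (hs_apply A e)) has_sum s) E)"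

definition trace_hamiltonian :: "nat \<Rightarrow> hs \<Rightarrow> real" where
  "trace_hamiltonian j K = hs_trace (hs_power K (j + 1)) / (2 * (real j + 1))"


section \<open>Smooth functions, submanifolds and Poisson structures\<close>

text \<open>Differentiability below is Frechet differentiability, but the derivative is iterated
  direction by direction, which keeps all iterates in the same function type. For a fixed order this
  is weaker than being \<open>k\<close> times Frechet differentiable; if all orders are required, the two notions
  coincide on open subsets of a Banach space. (By the uniform boundedness principle all iterated
  derivatives are locally bounded multilinear forms, hence each of them is locally Lipschitz in norm
  by the mean value theorem.)\<close>

primrec times_differentiable_on ::
  "nat \<Rightarrow> 'a::real_normed_vector set \<Rightarrow> ('a \<Rightarrow> 'b::real_normed_vector) \<Rightarrow> bool" where
  "times_differentiable_on 0 U f \<longleftrightarrow> continuous_on U f"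
| "times_differentiable_on (Suc k) U f \<longleftrightarrow> (\<forall>x\<in>U. f differentiable (at x)) \<and>
     (\<forall>v. times_differentiable_on k U (\<lambda>x. frechet_derivative f (at x) v))"

definition smooth_on :: "'a::real_normed_vector set \<Rightarrow> ('a \<Rightarrow> 'b::real_normed_vector) \<Rightarrow> bool" where
  "smooth_on U f \<longleftrightarrow> (\<forall>k. times_differentiable_on k U f)"

text \<open>The model spaces \<open>E\<close> need no complement condition: closed subspaces of a Hilbert space are
  complemented.\<close>

definition submanifold :: "hs set \<Rightarrow> bool" where
  "submanifold S \<longleftrightarrow> (\<forall>K\<in>S. \<exists>U V \<phi> \<psi> E. open U \<and> K \<in> U \<and> open V \<and>
     smooth_on U \<phi> \<and> smooth_on V \<psi> \<and> \<phi> ` U = V \<and> \<psi> ` V = U \<and>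
     (\<forall>x\<in>U. \<psi> (\<phi> x) = x) \<and> (\<forall>y\<in>V. \<phi> (\<psi> y) = y) \<and>
     subspace E \<and> closed (E :: hs set) \<and> \<phi> ` (S \<inter> U) = E \<inter> V)"

definition tangent_space :: "hs set \<Rightarrow> hs \<Rightarrow> hs set" where
  "tangent_space S K = {v. \<exists>\<gamma> \<epsilon>. \<epsilon> > 0 \<and> smooth_on {-\<epsilon><..<\<epsilon>} \<gamma> \<and> \<gamma> ` {-\<epsilon><..<\<epsilon>} \<subseteq> S \<and>
     \<gamma> 0 = K \<and> (\<gamma> has_vector_derivative v) (at (0::real))}"

definition grad :: "(hs \<Rightarrow> real) \<Rightarrow> hs \<Rightarrow> hs" where
  "grad F K = (THE A. \<forall>K'. ((\<lambda>t. F (K + t *\<^sub>R K')) has_real_derivative hs_pairing A K') (at 0))"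

definition poisson_R :: "(hs \<Rightarrow> real) \<Rightarrow> (hs \<Rightarrow> real) \<Rightarrow> hs \<Rightarrow> real" where
  "poisson_R F1 F2 K = hs_pairing K (lie_R (grad F1 K) (grad F2 K))"

text \<open>The curve \<open>c\<close> only has to have velocity \<open>X (c t)\<close> at the one time \<open>t\<close> considered. Integral
  curves are such curves at all their times, and through every point there is at least the straight
  line with velocity \<open>X\<close> there, so that the condition is never vacuous.\<close>

definition is_hamiltonian_vf :: "(hs \<Rightarrow> real) \<Rightarrow> (hs \<Rightarrow> hs) \<Rightarrow> bool" where
  "is_hamiltonian_vf H X \<longleftrightarrow> (\<forall>F. smooth_on UNIV F \<longrightarrow> (\<forall>c t.
     (c has_vector_derivative X (c t)) (at t) \<longrightarrow>
     ((\<lambda>s. F (c s)) has_real_derivative poisson_R F H (c t)) (at t)))"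

definition hamiltonian_vf :: "(hs \<Rightarrow> real) \<Rightarrow> hs \<Rightarrow> hs" where
  "hamiltonian_vf H = (THE X. is_hamiltonian_vf H X)"

definition poisson_submanifold :: "hs set \<Rightarrow> bool" where
  "poisson_submanifold S \<longleftrightarrow> submanifold S \<and>
     (\<forall>F. smooth_on UNIV F \<longrightarrow> (\<forall>K\<in>S. hamiltonian_vf F K \<in> tangent_space S K))"

text \<open>\<open>F\<close> extends \<open>f\<close>, a function on the submanifold \<open>S\<close>, smoothly to a neighbourhood of \<open>K\<close>.\<close>

definition local_extension :: "hs set \<Rightarrow> (hs \<Rightarrow> real) \<Rightarrow> hs \<Rightarrow> (hs \<Rightarrow> real) \<Rightarrow> bool" where
  "local_extension S f K F \<longleftrightarrow>
     (\<exists>U. open U \<and> K \<in> U \<and> smooth_on U F \<and> (\<forall>x\<in>S \<inter> U. F x = f x))"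

definition smooth_on_submanifold :: "hs set \<Rightarrow> (hs \<Rightarrow> real) \<Rightarrow> bool" where
  "smooth_on_submanifold S f \<longleftrightarrow> (\<forall>K\<in>S. \<exists>F. local_extension S f K F)"

text \<open>The description operator makes independence of the chosen extensions part of every
  statement about the induced bracket.\<close>

definition induced_poisson :: "hs set \<Rightarrow> (hs \<Rightarrow> real) \<Rightarrow> (hs \<Rightarrow> real) \<Rightarrow> hs \<Rightarrow> real" where
  "induced_poisson S f1 f2 K = (THE r. \<forall>F1 F2.
     local_extension S f1 K F1 \<longrightarrow> local_extension S f2 K F2 \<longrightarrow> poisson_R F1 F2 K = r)"

text \<open>The vector field \<open>V\<close> along \<open>S\<close> is the Hamiltonian vector field of \<open>h\<close> (restricted to \<open>S\<close>) for
  the induced Poisson structure.\<close>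

definition hamiltonian_on :: "hs set \<Rightarrow> (hs \<Rightarrow> real) \<Rightarrow> (hs \<Rightarrow> hs) \<Rightarrow> bool" where
  "hamiltonian_on S h V \<longleftrightarrow> smooth_on_submanifold S h \<and> (\<forall>K\<in>S. V K \<in> tangent_space S K) \<and>
     (\<forall>f. smooth_on_submanifold S f \<longrightarrow> (\<forall>c t.
        (\<forall>s. c s \<in> S) \<longrightarrow> (c has_vector_derivative V (c t)) (at t) \<longrightarrow>
        ((\<lambda>s. f (c s)) has_real_derivative induced_poisson S f h (c t)) (at t)))"

definition evolves_by :: "real set \<Rightarrow> (hs \<Rightarrow> hs) \<Rightarrow> (real \<Rightarrow> hs) \<Rightarrow> bool" where
  "evolves_by T X c \<longleftrightarrow> (\<forall>t\<in>T. (c has_vector_derivative X (c t)) (at t))"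

text \<open>The kernel of the velocity of \<open>c\<close>, the derivative being taken in Hilbert-Schmidt norm, is given by \<open>G\<close>.\<close>

definition kernel_equation :: "real set \<Rightarrow> (real \<Rightarrow> hs) \<Rightarrow> (real \<Rightarrow> real \<Rightarrow> real \<Rightarrow> real) \<Rightarrow> bool" where
  "kernel_equation T c G \<longleftrightarrow> (\<forall>t\<in>T. \<exists>D d. (c has_vector_derivative D) (at t) \<and> represents d D \<and>
     (AE (x, y) in lborel. d (x, y) = G t x y))"

end

theory Submission
  imports Defs
begin

text \<open>
  The proof rests on an explicit formula for the Hamiltonian vector fields. Write \<open>R = 1 - 2 P\<close>
  with \<open>P = proj_skew\<close>. The pairing is the trace of a product, so it is invariant, and
  \<open>(K, [A, B]\<^sub>R) = (A, X)\<close> holds with \<open>X = P' [B, K] - [P B, K]\<close>, where \<open>P'\<close> is the adjoint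
  of \<open>proj_volterra\<close> for the pairing (\<open>pairing_lie_R\<close>). The pairing is non-degenerate and, by
  the Riesz representation theorem, derivatives are given by gradients; hence \<open>X\<close> with
  \<open>B = grad H K\<close> is the Hamiltonian vector field of \<open>H\<close> (\<open>hamiltonian_vf_eq\<close>).

  The operator \<open>P'\<close> takes selfadjoint values, as its range annihilates the skew operators, and
  the commutator of a skew with a selfadjoint operator is selfadjoint. So every Hamiltonian vector
  field is tangent to the linear subspace of selfadjoint operators
  (\<open>poisson_submanifold_selfadjoint_ops\<close>). Tangency makes the bracket of two functions depend
  only on the restriction of the first one, and antisymmetry gives the same for the second
  (\<open>poisson_R_local_extension\<close>): the bracket descends to the submanifold.

  The trace Hamiltonian \<open>H\<^sub>j\<close> is a continuous polynomial, because the trace of a product of two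
  Hilbert-Schmidt operators is their pairing (\<open>hs_trace_comp\<close>). Its gradient is \<open>K ^ j / 2\<close>, by
  cyclicity (\<open>grad_trace_hamiltonian\<close>). This commutes with \<open>K\<close>, so \<open>X\<close> loses its first term
  and becomes \<open>[proj_volterra (K ^ j), K] / 2\<close> (\<open>ham_vec_commuting\<close>). For \<open>j = 1\<close> the kernel
  of this commutator is computed from the kernel of \<open>proj_volterra K\<close>, which is
  \<open>k (x, y) + k (y, x)\<close> below the diagonal and zero above it (\<open>AE_flow_kernel\<close>).

  The analytic input is the completeness of the spaces of square-integrable functions and the fact
  that an operator determines its kernel (\<open>hs_eq_0I\<close>). Completeness yields orthonormal bases and
  Parseval's identity, applied both in \<open>L\<^sup>2(\<real>)\<close> and, with the basis of rank one operators, in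
  the space of Hilbert-Schmidt operators (\<open>inner_has_sum_basis\<close>). From there, algebraic
  identities such as associativity, cyclicity and the behaviour of adjoints follow by testing
  operators on vectors.
\<close>

section \<open>Orthogonal complements, Riesz representation and Parseval's identity\<close>

lemma parallelogram:
  fixes a b :: "'a::real_inner"
  shows "(norm (a + b))\<^sup>2 + (norm (a - b))\<^sup>2 = 2 * (norm a)\<^sup>2 + 2 * (norm b)\<^sup>2"
  by (simp add: power2_norm_eq_inner inner_add_left inner_add_right inner_diff_left inner_diff_right
      inner_commute)

text \<open>A minimizing sequence for the distance from \<open>x\<close> to \<open>M\<close> is Cauchy by the
  parallelogram identity, because midpoints of its members also lie in \<open>M\<close>; the difference
  between \<open>x\<close> and its limit is orthogonal to \<open>M\<close>.\<close>

lemma ex_orthogonal_to_complete_subspace: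
  fixes M :: "'a::real_inner set"
  assumes M: "subspace M" "complete M" and x: "x \<notin> M"
  shows "\<exists>y. y \<noteq> 0 \<and> (\<forall>m\<in>M. inner y m = 0)"
proof -
  define d where "d = infdist x M"
  have ne: "M \<noteq> {}" using M(1) subspace_0 by auto
  have d0: "0 \<le> d" by (simp add: d_def infdist_nonneg)
  have dle: "d \<le> norm (x - m)" if "m \<in> M" for m
    using infdist_le[OF that, of x] by (simp add: d_def dist_norm)
  have "\<exists>m\<in>M. norm (x - m) < d + 1 / Suc n" for n
  proof -
    have "infdist x M < d + 1 / Suc n" by (simp add: d_def)
    then have "\<exists>m\<in>M. dist x m < d + 1 / Suc n"
      using ne by (simp add: infdist_notempty cINF_less_iff bdd_below_image_dist del: of_nat_Suc)
    then show ?thesis by (simp add: dist_norm)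
  qed
  then obtain m where m: "\<And>n. m n \<in> M" "\<And>n. norm (x - m n) < d + 1 / Suc n"
    by metis
  define q where "q n = 2 * (d + 1 / Suc n)\<^sup>2 - 2 * d\<^sup>2" for n
  have "(\<lambda>n. d + 1 / Suc n) \<longlonglongrightarrow> d"
    using tendsto_add[OF tendsto_const[of d] LIMSEQ_inverse_real_of_nat] by (simp add: field_simps)
  then have q: "q \<longlonglongrightarrow> 0"
    using tendsto_diff[OF tendsto_mult[OF tendsto_const[of 2] tendsto_power[of _ d _ 2]]
        tendsto_const[of "2 * d\<^sup>2"]]
    unfolding q_def by fastforce
  have dist: "(norm (m i - m j))\<^sup>2 \<le> q i + q j" for i j
  proof -
    have "(1/2) *\<^sub>R (m i + m j) \<in> M"
      using M(1) m(1) by (intro subspace_scale subspace_add) auto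
    then have "d \<le> norm (x - (1/2) *\<^sub>R (m i + m j))" by (rule dle)
    moreover have "(x - m i) + (x - m j) = 2 *\<^sub>R (x - (1/2) *\<^sub>R (m i + m j))"
      by (simp add: algebra_simps scaleR_2)
    ultimately have "2 * d \<le> norm ((x - m i) + (x - m j))" by simp
    then have "4 * d\<^sup>2 \<le> (norm ((x - m i) + (x - m j)))\<^sup>2"
      using power_mono[of "2 * d" _ 2] d0 by (simp add: power_mult_distrib)
    moreover have "(norm (x - m n))\<^sup>2 \<le> (d + 1 / Suc n)\<^sup>2" for n
      using m(2)[of n] by (intro power_mono) auto
    note this[of i] this[of j]
    moreover have "norm ((x - m i) - (x - m j)) = norm (m i - m j)"
      by (simp add: norm_minus_commute)
    ultimately show ?thesis
      using parallelogram[of "x - m i" "x - m j"] unfolding q_def by simp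
  qed
  have "Cauchy m"
  proof (rule metric_CauchyI)
    fix e :: real assume e: "0 < e"
    then have "0 < e\<^sup>2 / 2" by simp
    then obtain N where N: "\<And>n. n \<ge> N \<Longrightarrow> q n < e\<^sup>2 / 2"
      using order_tendstoD(2)[OF q] unfolding eventually_sequentially by blast
    show "\<exists>N. \<forall>i\<ge>N. \<forall>j\<ge>N. dist (m i) (m j) < e"
    proof (intro exI allI impI)
      fix i j assume "i \<ge> N" "j \<ge> N"
      then have "(norm (m i - m j))\<^sup>2 < e\<^sup>2"
        using dist[of i j] N[of i] N[of j] by linarith
      then show "dist (m i) (m j) < e"
        using e by (simp add: dist_norm power_less_imp_less_base)
    qed
  qed
  then obtain p where p: "p \<in> M" "m \<longlonglongrightarrow> p"
    using M(2) m(1) unfolding complete_def by blast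
  have "norm (x - p) \<le> d"
  proof (rule LIMSEQ_le)
    show "(\<lambda>n. norm (x - m n)) \<longlonglongrightarrow> norm (x - p)" using p by (intro tendsto_intros)
    show "(\<lambda>n. d + 1 / Suc n) \<longlonglongrightarrow> d" by fact
  qed (use m(2) in \<open>auto intro: less_imp_le\<close>)
  moreover have "inner (x - p) v = 0" if v: "v \<in> M" for v
  proof (rule ccontr)
    let ?a = "inner (x - p) v"
    assume a: "?a \<noteq> 0"
    then have v0: "inner v v > 0" by auto
    \<comment> \<open>the projection of \<open>x - p\<close> onto the line through \<open>v\<close> would bring \<open>p\<close> nearer to \<open>x\<close>\<close>
    define t where "t = ?a / inner v v"
    have "p + t *\<^sub>R v \<in> M" using M(1) p(1) v by (intro subspace_scale subspace_add) auto
    then have "norm (x - p) \<le> norm (x - (p + t *\<^sub>R v))"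
      using dle \<open>norm (x - p) \<le> d\<close> order_trans by blast
    then have "(norm (x - p))\<^sup>2 \<le> (norm ((x - p) - t *\<^sub>R v))\<^sup>2"
      by (simp add: diff_diff_eq power_mono)
    also have "\<dots> = (norm (x - p))\<^sup>2 - 2 * t * ?a + t * t * inner v v"
      unfolding power2_norm_eq_inner
      by (simp add: inner_diff_left inner_diff_right inner_commute algebra_simps)
    also have "\<dots> = (norm (x - p))\<^sup>2 - ?a\<^sup>2 / inner v v"
      using v0 by (simp add: t_def field_simps power2_eq_square)
    finally show False using a v0 by (simp add: field_simps)
  qed
  moreover have "x - p \<noteq> 0" using p(1) x by auto
  ultimately show ?thesis by blast
qed

lemma subspace_closure:
  fixes S :: "'a::real_normed_vector set"
  assumes "subspace S"
  shows "subspace (closure S)"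
proof -
  have "0 \<in> closure S" using assms closure_subset subspace_0 by blast
  moreover have "x + y \<in> closure S" if x: "x \<in> closure S" and y: "y \<in> closure S" for x y
  proof -
    obtain f where "\<And>n. f n \<in> S" "f \<longlonglongrightarrow> x"
      using x unfolding closure_sequential by blast
    moreover obtain g where "\<And>n. g n \<in> S" "g \<longlonglongrightarrow> y"
      using y unfolding closure_sequential by blast
    ultimately show ?thesis unfolding closure_sequential using assms
      by (intro exI[of _ "\<lambda>n. f n + g n"]) (auto intro: tendsto_add subspace_add)
  qed
  moreover have "c *\<^sub>R x \<in> closure S" if x: "x \<in> closure S" for x c
  proof -
    obtain f where "\<And>n. f n \<in> S" "f \<longlonglongrightarrow> x"
      using x unfolding closure_sequential by blast
    then show ?thesis unfolding closure_sequential using assms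
      by (intro exI[of _ "\<lambda>n. c *\<^sub>R f n"]) (auto intro!: tendsto_scaleR subspace_scale)
  qed
  ultimately show ?thesis by (auto simp: subspace_def)
qed

lemma closure_span_eq_UNIV:
  fixes S :: "'a::{real_inner,complete_space} set"
  assumes "\<And>y. (\<And>s. s \<in> S \<Longrightarrow> inner y s = 0) \<Longrightarrow> y = 0"
  shows "closure (span S) = UNIV"
proof (rule ccontr)
  assume "closure (span S) \<noteq> UNIV"
  then obtain x where x: "x \<notin> closure (span S)" by auto
  obtain y where "y \<noteq> 0" "\<forall>m\<in>closure (span S). inner y m = 0"
    using ex_orthogonal_to_complete_subspace[OF subspace_closure _ x]
    by (auto simp: complete_eq_closed)
  moreover have "s \<in> closure (span S)" if "s \<in> S" for s
    using that closure_subset span_base by blast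
  ultimately show False using assms by blast
qed

text \<open>A vector orthogonal to the kernel of \<open>f\<close> determines \<open>f\<close> up to a factor, since the kernel
  has codimension one.\<close>

lemma riesz_representation:
  fixes f :: "'a::{real_inner,complete_space} \<Rightarrow> real"
  assumes f: "bounded_linear f"
  shows "\<exists>y. \<forall>x. f x = inner x y"
proof (cases "\<forall>x. f x = 0")
  case True
  then show ?thesis by (intro exI[of _ 0]) simp
next
  case False
  interpret f: bounded_linear f by fact
  let ?M = "{x. f x = 0}"
  have "subspace ?M" by (auto simp: subspace_def f.zero f.add f.scaleR)
  moreover have "complete ?M"
    unfolding complete_eq_closed
    by (intro closed_Collect_eq continuous_intros f.continuous_on)
  ultimately obtain y where y: "y \<noteq> 0" "\<And>m. f m = 0 \<Longrightarrow> inner y m = 0"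
    using False ex_orthogonal_to_complete_subspace by blast
  have fy: "f y \<noteq> 0" using y by fastforce
  show ?thesis
  proof (intro exI allI)
    fix x
    have "inner y (x - (f x / f y) *\<^sub>R y) = 0"
      using fy by (intro y(2)) (simp add: f.diff f.scaleR)
    then show "f x = inner x ((f y / inner y y) *\<^sub>R y)"
      using fy y(1) by (simp add: inner_diff_right inner_commute field_simps)
  qed
qed

text \<open>An orthonormal set that is maximal, which exists by Zorn's lemma, has no nonzero vector
  orthogonal to it.\<close>

lemma ex_orthonormal_basis: "\<exists>E :: 'a::{real_inner,complete_space} set. orthonormal_basis E"
proof -
  define \<O> where "\<O> = {E :: 'a set. (\<forall>e\<in>E. norm e = 1) \<and> pairwise orthogonal E}"
  have "\<exists>E\<in>\<O>. \<forall>F\<in>\<O>. E \<subseteq> F \<longrightarrow> F = E"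
  proof (rule subset_Zorn')
    fix C assume C: "subset.chain \<O> C"
    have "orthogonal e e'" if e: "e \<in> \<Union>C" "e' \<in> \<Union>C" "e \<noteq> e'" for e e'
    proof -
      obtain E E' where E: "E \<in> C" "e \<in> E" "E' \<in> C" "e' \<in> E'" using e by blast
      then have "E \<subseteq> E' \<or> E' \<subseteq> E" using C by (auto simp: subset.chain_def)
      moreover have "pairwise orthogonal E" "pairwise orthogonal E'"
        using E C by (auto simp: subset.chain_def \<O>_def)
      ultimately show ?thesis using E e(3) by (auto dest: pairwiseD)
    qed
    then show "\<Union>C \<in> \<O>" using C by (auto simp: subset.chain_def \<O>_def pairwise_def)
  qed
  then obtain E where E: "E \<in> \<O>" and max: "\<And>F. F \<in> \<O> \<Longrightarrow> E \<subseteq> F \<Longrightarrow> F = E" by blast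
  have "closure (span E) = UNIV"
  proof (rule closure_span_eq_UNIV, rule ccontr)
    fix y assume y: "\<And>s. s \<in> E \<Longrightarrow> inner y s = 0" "y \<noteq> 0"
    let ?u = "y /\<^sub>R norm y"
    have "insert ?u E \<in> \<O>"
      using E y by (auto simp: \<O>_def pairwise_insert orthogonal_def inner_commute)
    then have "?u \<in> E" using max by blast
    then show False using y by force
  qed
  then show ?thesis using E by (auto simp: orthonormal_basis_def \<O>_def)
qed

text \<open>The left-hand side is the squared distance from \<open>x\<close> to its orthogonal projection onto the
  span of \<open>F\<close>.\<close>

lemma orthonormal_best_approximation:
  fixes F :: "'a::real_inner set"
  assumes F: "finite F" "\<And>e. e \<in> F \<Longrightarrow> norm e = 1" "pairwise orthogonal F" and s: "s \<in> span F"
  shows "(norm x)\<^sup>2 - (\<Sum>e\<in>F. (inner x e)\<^sup>2) \<le> (norm (x - s))\<^sup>2"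
proof -
  obtain u where u: "s = (\<Sum>e\<in>F. u e *\<^sub>R e)" using s F(1) by (auto simp: span_finite)
  have "inner s s = (\<Sum>e\<in>F. \<Sum>e'\<in>F. u e * u e' * inner e e')"
    unfolding u inner_sum_left inner_sum_right by (simp add: mult_ac inner_commute)
  also have "\<dots> = (\<Sum>e\<in>F. \<Sum>e'\<in>F. if e' = e then (u e)\<^sup>2 else 0)"
    using F(2,3) by (intro sum.cong refl)
      (auto simp: pairwise_def orthogonal_def power2_eq_square dot_square_norm)
  also have "\<dots> = (\<Sum>e\<in>F. (u e)\<^sup>2)" using F(1) by simp
  finally have ss: "inner s s = (\<Sum>e\<in>F. (u e)\<^sup>2)" .
  have xs: "inner x s = (\<Sum>e\<in>F. u e * inner x e)"
    unfolding u by (simp add: inner_sum_right)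
  have "0 \<le> (\<Sum>e\<in>F. (inner x e - u e)\<^sup>2)" by (simp add: sum_nonneg)
  also have "\<dots> = (\<Sum>e\<in>F. (inner x e)\<^sup>2) - 2 * inner x s + inner s s"
    unfolding ss xs by (simp add: power2_diff sum.distrib sum_subtractf sum_distrib_left mult_ac)
  finally show ?thesis
    unfolding power2_norm_eq_inner
    by (simp add: inner_diff_left inner_diff_right inner_commute)
qed

text \<open>Once a finite part of \<open>E\<close> spans a good approximation of \<open>x\<close>, every larger finite part
  approximates \<open>x\<close> at least as well; Bessel's inequality bounds the partial sums from above.\<close>

lemma parseval_norm:
  fixes E :: "'a::real_inner set"
  assumes E: "orthonormal_basis E"
  shows "((\<lambda>e. (inner x e)\<^sup>2) has_sum (norm x)\<^sup>2) E"
  unfolding has_sum_def tendsto_iff eventually_finite_subsets_at_top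
proof (intro allI impI)
  fix r :: real assume r: "0 < r"
  have E': "\<And>e. e \<in> E \<Longrightarrow> norm e = 1" "pairwise orthogonal E" "x \<in> closure (span E)"
    using E by (auto simp: orthonormal_basis_def)
  obtain s where s: "s \<in> span E" "dist s x < sqrt r"
    using E'(3) r unfolding closure_approachable by (meson real_sqrt_gt_zero)
  obtain F where F: "finite F" "F \<subseteq> E" "s \<in> span F"
  proof -
    obtain F u where F: "finite F" "F \<subseteq> E" "s = (\<Sum>e\<in>F. u e *\<^sub>R e)"
      using s(1) unfolding span_explicit by blast
    moreover have "s \<in> span F" unfolding F(3) by (intro span_sum span_scale span_base)
    ultimately show thesis using that by blast
  qed
  show "\<exists>X. finite X \<and> X \<subseteq> E \<and> (\<forall>Y. finite Y \<and> X \<subseteq> Y \<and> Y \<subseteq> E \<longrightarrow>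
      dist (\<Sum>e\<in>Y. (inner x e)\<^sup>2) ((norm x)\<^sup>2) < r)"
  proof (intro exI conjI allI impI)
    fix Y assume Y: "finite Y \<and> F \<subseteq> Y \<and> Y \<subseteq> E"
    have Y': "\<And>e. e \<in> Y \<Longrightarrow> norm e = 1" "pairwise orthogonal Y"
      using Y E' by (auto intro: pairwise_subset)
    have "(norm x)\<^sup>2 - (\<Sum>e\<in>Y. (inner x e)\<^sup>2) \<le> (norm (x - s))\<^sup>2"
      using Y Y' F(3) span_mono by (intro orthonormal_best_approximation) auto
    also have "\<dots> < r"
      using s(2) r by (metis dist_commute dist_norm norm_ge_zero power_strict_mono
          real_sqrt_pow2 less_imp_le zero_less_numeral)
    finally have "(norm x)\<^sup>2 - (\<Sum>e\<in>Y. (inner x e)\<^sup>2) < r" .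
    moreover have "(\<Sum>e\<in>Y. (inner x e)\<^sup>2) \<le> (norm x)\<^sup>2"
    proof -
      let ?p = "\<Sum>e\<in>Y. inner x e *\<^sub>R e"
      have px: "inner x ?p = (\<Sum>e\<in>Y. (inner x e)\<^sup>2)"
        by (simp add: inner_sum_right power2_eq_square)
      have "?p \<in> span Y" by (intro span_sum span_scale span_base)
      then have "inner ?p ?p - (\<Sum>e\<in>Y. (inner ?p e)\<^sup>2) \<le> 0"
        using orthonormal_best_approximation[of Y ?p ?p] Y Y' by (simp add: power2_norm_eq_inner)
      moreover have "inner ?p e = inner x e" if "e \<in> Y" for e
      proof -
        have "inner ?p e = (\<Sum>e'\<in>Y. if e' = e then inner x e else 0)"
          unfolding inner_sum_left using Y' that
          by (intro sum.cong refl) (auto simp: pairwise_def orthogonal_def dot_square_norm)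
        then show ?thesis using Y that by simp
      qed
      ultimately have "inner ?p ?p \<le> inner x ?p" using px by simp
      then have "0 \<le> inner x x - inner x ?p"
        using inner_ge_zero[of "x - ?p"]
        by (simp add: inner_diff_left inner_diff_right inner_commute)
      then show ?thesis using px by (simp add: power2_norm_eq_inner)
    qed
    ultimately show "dist (\<Sum>e\<in>Y. (inner x e)\<^sup>2) ((norm x)\<^sup>2) < r"
      by (simp add: dist_real_def)
  qed (use F in auto)
qed

lemma parseval:
  fixes E :: "'a::real_inner set"
  assumes E: "orthonormal_basis E"
  shows "((\<lambda>e. inner x e * inner y e) has_sum inner x y) E"
proof -
  have "((\<lambda>e. (1/4) * (inner (x + y) e)\<^sup>2 + (-1/4) * (inner (x - y) e)\<^sup>2) has_sum
      (1/4) * (norm (x + y))\<^sup>2 + (-1/4) * (norm (x - y))\<^sup>2) E"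
    by (intro has_sum_add has_sum_cmult_right parseval_norm E)
  moreover have "(1/4) * (norm (x + y))\<^sup>2 + (-1/4) * (norm (x - y))\<^sup>2 = inner x y"
    by (simp add: power2_norm_eq_inner inner_add_left inner_add_right inner_diff_left
        inner_diff_right inner_commute field_simps)
  moreover have "(1/4) * (inner (x + y) e)\<^sup>2 + (-1/4) * (inner (x - y) e)\<^sup>2 = inner x e * inner y e" for e
    by (simp add: inner_add_left inner_diff_left power2_eq_square algebra_simps)
  ultimately show ?thesis by simp
qed

section \<open>Completeness of the space of square-integrable functions\<close>

lemma represents_square_integrable: "represents f A \<Longrightarrow> square_integrable f"
  by (simp add: represents_def)

lemma represents_abs: "square_integrable f \<Longrightarrow> represents f (abs_l2 f)"
  by (simp add: represents_def)

lemma abs_l2_eq_iff: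
  assumes "square_integrable f" "square_integrable g"
  shows "abs_l2 f = abs_l2 g \<longleftrightarrow> (AE x in lborel. f x = g x)"
  using Quotient3_rel[OF Quotient3_l2, of f g] assms by (auto simp: l2rel_def)

lemma represents_eq_iff:
  assumes "represents f A" "represents g B"
  shows "A = B \<longleftrightarrow> (AE x in lborel. f x = g x)"
  using abs_l2_eq_iff[of f g] assms by (auto simp: represents_def)

lemma represents_add:
  "represents f A \<Longrightarrow> represents g B \<Longrightarrow> represents (\<lambda>x. f x + g x) (A + B)"
  by (auto simp: represents_def square_integrable_add l2rel_def intro!: plus_l2.abs_eq[symmetric])

lemma represents_diff:
  "represents f A \<Longrightarrow> represents g B \<Longrightarrow> represents (\<lambda>x. f x - g x) (A - B)"
  by (auto simp: represents_def square_integrable_diff l2rel_def intro!: minus_l2.abs_eq[symmetric])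

lemma represents_scaleR:
  "represents f A \<Longrightarrow> represents (\<lambda>x. c * f x) (c *\<^sub>R A)"
  by (auto simp: represents_def square_integrable_cmult l2rel_def intro!: scaleR_l2.abs_eq[symmetric])

lemma represents_zero: "represents (\<lambda>x. 0) 0"
  by (simp add: represents_def square_integrable_zero zero_l2_def)

lemma inner_represents:
  "represents f A \<Longrightarrow> represents g B \<Longrightarrow> inner A B = (\<integral>x. f x * g x \<partial>lborel)"
  by (auto simp: represents_def l2rel_def inner_l2.abs_eq)

lemma norm_represents:
  "represents f A \<Longrightarrow> (norm A)\<^sup>2 = (\<integral>x. (f x)\<^sup>2 \<partial>lborel)"
  unfolding power2_norm_eq_inner by (simp add: inner_represents power2_eq_square)

text \<open>The two summands on the right are what is controlled when \<open>a\<close> is an increment of a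
  sequence that converges fast in norm: the first by its integral, the second by a geometric
  series. With \<open>t = 2 ^ n * \<bar>a\<bar>\<close> the inequality is \<open>t \<le> t ^ 2 + 1\<close>.\<close>

lemma abs_le_weighted_square: "\<bar>a\<bar> \<le> 2 ^ n * a\<^sup>2 + (1/2 :: real) ^ n"
proof -
  let ?t = "2 ^ n * \<bar>a\<bar>"
  have "?t \<le> ?t\<^sup>2 + 1" using zero_le_power2[of "?t - 1/2"]  by (simp add: power2_diff power_divide)
  then have "?t / 2 ^ n \<le> (?t\<^sup>2 + 1) / 2 ^ n" by (intro divide_right_mono) auto
  then show ?thesis by (simp add: power2_eq_square field_simps)
qed

text \<open>Riesz-Fischer. A subsequence with geometrically small increments converges almost
  everywhere, and by Fatou's lemma its pointwise limit is also the limit in norm.\<close>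

instance l2 :: (euclidean_space) complete_space
proof
  fix X :: "nat \<Rightarrow> 'a l2" assume "Cauchy X"
  then have "\<exists>N. \<forall>i\<ge>N. \<forall>j\<ge>N. dist (X i) (X j) < (1/2) ^ n" for n
    by (intro metric_CauchyD) auto
  then obtain N where N: "\<And>n i j. i \<ge> N n \<Longrightarrow> j \<ge> N n \<Longrightarrow> dist (X i) (X j) < (1/2) ^ n"
    by metis
  \<comment> \<open>partial sums make the bound for \<open>n\<close> available at all later indices\<close>
  define r where "r n = (\<Sum>k\<le>n. N k)" for n
  have r: "N n \<le> r m" if "n \<le> m" for n m
    unfolding r_def using that by (intro member_le_sum) auto
  define f where "f n = rep_l2 (X (r n))" for n
  have f: "represents (f n) (X (r n))" for n
    unfolding f_def by (rule represents_rep)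
  have [measurable]: "f n \<in> borel_measurable borel" for n
    using f square_integrableD represents_square_integrable by blast
  have int: "integrable lborel (\<lambda>x. (f m x - f n x)\<^sup>2)" for m n
    using represents_square_integrable[OF represents_diff[OF f f]] by (rule square_integrable_sq)
  have close: "(\<integral>x. (f n x - f m x)\<^sup>2 \<partial>lborel) \<le> (1/4) ^ n" if "n \<le> m" for n m
  proof -
    have "norm (X (r n) - X (r m)) < (1/2) ^ n"
      using N[of n "r n" "r m"] r that by (simp add: dist_norm)
    then have "(norm (X (r n) - X (r m)))\<^sup>2 \<le> ((1/2) ^ n)\<^sup>2" by (intro power_mono) auto
    also have "((1/2::real) ^ n)\<^sup>2 = (1/4) ^ n"
      by (simp add: power_mult[symmetric] mult.commute[of n] power_divide) (simp add: power_mult)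
    finally show ?thesis unfolding norm_represents[OF represents_diff[OF f f]] .
  qed
  have "(\<integral>\<^sup>+x. (\<Sum>n. ennreal (2 ^ n * (f n x - f (Suc n) x)\<^sup>2)) \<partial>lborel)
      = (\<Sum>n. \<integral>\<^sup>+x. ennreal (2 ^ n * (f n x - f (Suc n) x)\<^sup>2) \<partial>lborel)"
    by (intro nn_integral_suminf) measurable
  also have "\<dots> = (\<Sum>n. ennreal (2 ^ n * (\<integral>x. (f n x - f (Suc n) x)\<^sup>2 \<partial>lborel)))"
    using int by (subst nn_integral_eq_integral) auto
  also have "\<dots> \<le> (\<Sum>n. ennreal ((1/2) ^ n))"
  proof (intro suminf_le ennreal_leI allI)
    fix n
    have "2 ^ n * (\<integral>x. (f n x - f (Suc n) x)\<^sup>2 \<partial>lborel) \<le> 2 ^ n * (1/4) ^ n"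
      by (intro mult_left_mono close) auto
    also have "\<dots> = (1/2 :: real) ^ n" by (simp add: power_mult_distrib[symmetric])
    finally show "2 ^ n * (\<integral>x. (f n x - f (Suc n) x)\<^sup>2 \<partial>lborel) \<le> (1/2) ^ n" .
  qed auto
  also have "\<dots> < \<infinity>"
    by (subst suminf_ennreal2) (auto intro: summable_geometric)
  finally have "AE x in lborel. (\<Sum>n. ennreal (2 ^ n * (f n x - f (Suc n) x)\<^sup>2)) \<noteq> \<infinity>"
    by (intro nn_integral_noteq_infinite) auto
  then have conv: "AE x in lborel. convergent (\<lambda>n. f n x)"
  proof eventually_elim
    case (elim x)
    have "summable (\<lambda>n. 2 ^ n * (f n x - f (Suc n) x)\<^sup>2)"
      using elim by (intro summable_suminf_not_top) auto
    then have "summable (\<lambda>n. 2 ^ n * (f n x - f (Suc n) x)\<^sup>2 + (1/2) ^ n)"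
      by (intro summable_add summable_geometric) auto
    then have "summable (\<lambda>n. f (Suc n) x - f n x)"
    proof (rule summable_comparison_test'[where N = 0])
      show "norm (f (Suc n) x - f n x) \<le> 2 ^ n * (f n x - f (Suc n) x)\<^sup>2 + (1/2) ^ n" for n
        using abs_le_weighted_square[of "f n x - f (Suc n) x" n] by (simp add: abs_minus_commute)
    qed
    then have "convergent (\<lambda>n. \<Sum>k<n. f (Suc k) x - f k x)"
      by (simp add: summable_iff_convergent)
    then have "convergent (\<lambda>n. f 0 x + (\<Sum>k<n. f (Suc k) x - f k x))"
      by (intro convergent_add convergent_const)
    then show ?case by (simp add: sum_lessThan_telescope[of "\<lambda>k. f k x"])
  qed
  define g where "g x = lim (\<lambda>n. f n x)" for x
  have [measurable]: "g \<in> borel_measurable borel"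
    unfolding g_def by measurable
  have lim: "AE x in lborel. (\<lambda>n. f n x) \<longlonglongrightarrow> g x"
    using conv unfolding g_def by eventually_elim (simp add: convergent_LIMSEQ_iff)
  have nn: "(\<integral>\<^sup>+x. ennreal ((f n x - g x)\<^sup>2) \<partial>lborel) \<le> ennreal ((1/4) ^ n)" for n
  proof -
    have "(\<integral>\<^sup>+x. ennreal ((f n x - g x)\<^sup>2) \<partial>lborel)
        = (\<integral>\<^sup>+x. liminf (\<lambda>m. ennreal ((f n x - f m x)\<^sup>2)) \<partial>lborel)"
      using lim
    proof (intro nn_integral_cong_AE, eventually_elim)
      case (elim x)
      then have "(\<lambda>m. ennreal ((f n x - f m x)\<^sup>2)) \<longlonglongrightarrow> ennreal ((f n x - g x)\<^sup>2)"
        by (intro tendsto_intros)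
      then show ?case by (metis lim_imp_Liminf trivial_limit_sequentially)
    qed
    also have "\<dots> \<le> liminf (\<lambda>m. \<integral>\<^sup>+x. ennreal ((f n x - f m x)\<^sup>2) \<partial>lborel)"
      by (intro nn_integral_liminf) measurable
    also have "\<dots> \<le> ennreal ((1/4) ^ n)"
    proof (rule Liminf_le)
      show "\<forall>\<^sub>F m in sequentially. (\<integral>\<^sup>+x. ennreal ((f n x - f m x)\<^sup>2) \<partial>lborel) \<le> ennreal ((1/4) ^ n)"
        using eventually_ge_at_top[of n]
        by eventually_elim (use int close in \<open>auto simp: nn_integral_eq_integral intro!: ennreal_leI\<close>)
    qed auto
    finally show ?thesis .
  qed
  have fg: "square_integrable (\<lambda>x. f n x - g x)" for n
    unfolding square_integrable_def
  proof
    show "integrable lborel (\<lambda>x. (f n x - g x)\<^sup>2)"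
      using nn[of n] by (intro integrableI_bounded) (auto simp: order_le_less_trans)
  qed simp
  have "square_integrable g"
    using square_integrable_diff[OF represents_square_integrable[OF f[of 0]] fg[of 0]] by simp
  then have g: "represents g (abs_l2 g)" by (rule represents_abs)
  have rg: "norm (X (r n) - abs_l2 g) \<le> (1/2) ^ n" for n
  proof -
    have "(norm (X (r n) - abs_l2 g))\<^sup>2 = (\<integral>x. (f n x - g x)\<^sup>2 \<partial>lborel)"
      by (rule norm_represents[OF represents_diff[OF f g]])
    also have "ennreal \<dots> \<le> ennreal ((1/4) ^ n)"
      using nn[of n] fg[of n] by (simp add: nn_integral_eq_integral square_integrable_sq)
    finally have "(norm (X (r n) - abs_l2 g))\<^sup>2 \<le> (1/4) ^ n" by simp
    also have "(1/4::real) ^ n = ((1/2) ^ n)\<^sup>2"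
      by (simp add: power_mult[symmetric] mult.commute[of n] power_divide) (simp add: power_mult)
    finally show ?thesis by (rule power2_le_imp_le) simp
  qed
  have "X \<longlonglongrightarrow> abs_l2 g"
  proof (rule metric_LIMSEQ_I)
    fix e :: real assume "0 < e"
    then obtain n where n: "(1/2) ^ n < e / 2"
      using real_arch_pow_inv[of "e/2" "1/2"] by auto
    show "\<exists>no. \<forall>m\<ge>no. dist (X m) (abs_l2 g) < e"
    proof (intro exI allI impI)
      fix m assume "r n \<le> m"
      then have "dist (X m) (X (r n)) < (1/2) ^ n" using r[of n n] by (intro N) auto
      moreover have "dist (X (r n)) (abs_l2 g) \<le> (1/2) ^ n" using rg by (simp add: dist_norm)
      ultimately show "dist (X m) (abs_l2 g) < e"
        using dist_triangle[of "X m" "abs_l2 g" "X (r n)"] n by linarith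
    qed
  qed
  then show "convergent X" by (rule convergentI)
qed

section \<open>The algebra of Hilbert-Schmidt operators\<close>

lemma indicator_power: "0 < n \<Longrightarrow> (indicator S x :: 'a::semiring_1) ^ n = indicator S x"
  by (simp add: indicator_def zero_power)

lemma square_integrable_indicator:
  "S \<in> sets borel \<Longrightarrow> bounded S \<Longrightarrow> square_integrable (indicator S :: 'a::euclidean_space \<Rightarrow> real)"
  using emeasure_bounded_finite[of S] by (simp add: square_integrable_def indicator_power)

lemma square_integrable_prod:
  assumes g: "square_integrable (g :: real \<Rightarrow> real)" and f: "square_integrable (f :: real \<Rightarrow> real)"
  shows "square_integrable (\<lambda>(x, y). g x * f y)"
proof -
  note [measurable] = g[THEN square_integrableD] f[THEN square_integrableD]
  have "integrable (lborel \<Otimes>\<^sub>M lborel) (\<lambda>(x, y). (g x)\<^sup>2 * (f y)\<^sup>2)"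
  proof (rule lborel_pair.Fubini_integrable)
    show "integrable lborel (\<lambda>x. \<integral>y. norm (case (x, y) of (x, y) \<Rightarrow> (g x)\<^sup>2 * (f y)\<^sup>2) \<partial>lborel)"
      using square_integrable_sq[OF g] by (simp add: abs_mult)
  qed (use square_integrable_sq[OF f] in auto)
  then have "integrable lborel (\<lambda>p. (case p of (x, y) \<Rightarrow> g x * f y)\<^sup>2)"
    by (simp add: lborel_prod case_prod_unfold power_mult_distrib)
  moreover have "(\<lambda>(x, y). g x * f y) \<in> borel_measurable borel"
    unfolding borel_prod[symmetric] by measurable
  ultimately show ?thesis by (simp add: square_integrable_def)
qed

lemma square_integrable_mult_indicator:
  assumes "square_integrable k" "S \<in> sets borel"
  shows "square_integrable (\<lambda>x. indicator S x * k x)"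
proof (rule square_integrable_bound[OF _ square_integrable_sq[OF assms(1)]])
  note [measurable] = assms(1)[THEN square_integrableD] assms(2)
  show "(\<lambda>x. indicator S x * k x) \<in> borel_measurable borel" by measurable
qed (auto simp: indicator_def)

lemma above_diagonal_borel: "{(x, y). (x :: real) < y} \<in> sets borel"
proof -
  have "Measurable.pred (borel \<Otimes>\<^sub>M borel) (\<lambda>(x :: real, y). x < y)" by measurable
  then show ?thesis by (simp add: pred_def borel_prod space_pair_measure case_prod_unfold)
qed

text \<open>The operator \<open>\<phi> \<mapsto> (f, \<phi>) g\<close>.\<close>

lift_definition rank_one :: "real l2 \<Rightarrow> real l2 \<Rightarrow> hs" is "\<lambda>g f (x, y). g x * f y"
proof -
  fix g g' f f' :: "real \<Rightarrow> real"
  assume r: "l2rel g g'" "l2rel f f'"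
  have "AE p in (lborel :: (real \<times> real) measure). g (fst p) = g' (fst p)"
    using AE_fst[of "\<lambda>x. g x = g' x"] r by (simp add: l2rel_def case_prod_unfold)
  moreover have "AE p in (lborel :: (real \<times> real) measure). f (snd p) = f' (snd p)"
    using AE_snd[of "\<lambda>x. f x = f' x"] r by (simp add: l2rel_def case_prod_unfold)
  ultimately have "AE p in lborel. (case p of (x, y) \<Rightarrow> g x * f y) = (case p of (x, y) \<Rightarrow> g' x * f' y)"
    by eventually_elim (simp add: case_prod_unfold)
  then show "l2rel (\<lambda>(x, y). g x * f y) (\<lambda>(x, y). g' x * f' y)"
    using r by (simp add: l2rel_def square_integrable_prod)
qed

lift_definition hs_transpose :: "hs \<Rightarrow> hs" is "\<lambda>a (x, y). a (y, x)"
proof -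
  fix a a' :: "real \<times> real \<Rightarrow> real" assume r: "l2rel a a'"
  have "AE (x, y) in (lborel :: (real \<times> real) measure). a (y, x) = a' (y, x)"
    using r by (intro AE_swap) (simp add: l2rel_def)
  then show "l2rel (\<lambda>(x, y). a (y, x)) (\<lambda>(x, y). a' (y, x))"
    using r square_integrable_swap[of a] square_integrable_swap[of a']
    by (simp add: l2rel_def case_prod_unfold)
qed

text \<open>This projection annihilates exactly the Volterra operators, and so describes them without a
  choice of kernel.\<close>

lift_definition upper :: "hs \<Rightarrow> hs" is "\<lambda>a p. indicator {(x, y). x < y} p * a p"
  by (auto simp: l2rel_def elim: eventually_mono
      intro: square_integrable_mult_indicator[OF _ above_diagonal_borel])

lemma represents_hs_transpose: "represents a A \<Longrightarrow> represents (\<lambda>(x, y). a (y, x)) (hs_transpose A)"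
  by (auto simp: represents_def l2rel_def square_integrable_swap intro!: hs_transpose.abs_eq[symmetric])

lemma represents_upper:
  "represents a A \<Longrightarrow> represents (\<lambda>p. indicator {(x, y). x < y} p * a p) (upper A)"
  by (auto simp: represents_def l2rel_def intro!: upper.abs_eq[symmetric]
      square_integrable_mult_indicator above_diagonal_borel)

lemma represents_comp:
  "represents a A \<Longrightarrow> represents b B \<Longrightarrow>
    represents (\<lambda>(x, y). \<integral>z. a (x, z) * b (z, y) \<partial>lborel) (A \<odot> B)"
  by (auto simp: represents_def l2rel_def square_integrable_comp intro!: hs_comp.abs_eq[symmetric])

lemma represents_apply:
  "represents a A \<Longrightarrow> represents f F \<Longrightarrow>
    represents (\<lambda>x. \<integral>y. a (x, y) * f y \<partial>lborel) (hs_apply A F)"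
  by (auto simp: represents_def l2rel_def square_integrable_apply intro!: hs_apply.abs_eq[symmetric])

lemma represents_rank_one:
  "represents g G \<Longrightarrow> represents f F \<Longrightarrow> represents (\<lambda>(x, y). g x * f y) (rank_one G F)"
  by (auto simp: represents_def l2rel_def square_integrable_prod intro!: rank_one.abs_eq[symmetric])

lemma inner_rank_one: "inner A (rank_one G F) = inner G (hs_apply A F)"
proof -
  obtain a g f where r: "represents a A" "represents g G" "represents f F"
    using represents_rep by metis
  have "integrable lborel (\<lambda>p. a p * (case p of (x, y) \<Rightarrow> g x * f y))"
    using r represents_rank_one by (intro square_integrable_mult represents_square_integrable)
  then have "integrable (lborel \<Otimes>\<^sub>M lborel) (\<lambda>p. a p * (case p of (x, y) \<Rightarrow> g x * f y))"
    by (simp add: lborel_prod)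
  from lborel_pair.integral_fst'[OF this]
  have "(\<integral>p. a p * (case p of (x, y) \<Rightarrow> g x * f y) \<partial>lborel)
      = (\<integral>x. g x * (\<integral>y. a (x, y) * f y \<partial>lborel) \<partial>lborel)"
    by (simp add: lborel_prod mult.left_commute)
  then show ?thesis
    using inner_represents[OF r(1) represents_rank_one[OF r(2,3)]]
      inner_represents[OF r(2) represents_apply[OF r(1,3)]] by simp
qed

text \<open>A kernel that integrates to zero over all bounded rectangles integrates to zero over every
  measurable part of a box, because rectangles generate the product sigma algebra and are closed
  under intersection.\<close>

lemma AE_zero_if_rectangle_integrals_zero:
  fixes a :: "real \<times> real \<Rightarrow> real"
  assumes a: "square_integrable a"
    and zero: "\<And>S T. S \<in> sets borel \<Longrightarrow> bounded S \<Longrightarrow> T \<in> sets borel \<Longrightarrow> bounded T \<Longrightarrow>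
      (\<integral>p. indicator (S \<times> T) p * a p \<partial>lborel) = 0"
  shows "AE p in lborel. a p = 0"
proof -
  note [measurable] = a[THEN square_integrableD]
  define I where "I n = {- real n..real n}" for n
  \<comment> \<open>truncation to a set of finite measure makes a square-integrable function integrable\<close>
  define b where "b n p = indicator (I n \<times> I n) p * a p" for n p
  have I: "I n \<in> sets borel" "bounded (I n)" for n by (auto simp: I_def)
  have "square_integrable (indicator (I n \<times> I n) :: real \<times> real \<Rightarrow> real)" for n
    unfolding I_def by (intro square_integrable_indicator bounded_Times) (auto simp: borel_prod[symmetric])
  then have b: "integrable lborel (b n)" for n
    unfolding b_def using a by (rule square_integrable_mult)
  then have [measurable]: "b n \<in> borel_measurable borel" for n
    using borel_measurable_integrable by fastforce
  have D: "(\<integral>p. indicator D p * b n p \<partial>lborel) = 0" if "D \<in> sets borel" for D n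
  proof -
    let ?G = "{S \<times> T |S T. S \<in> sets (borel :: real measure) \<and> T \<in> sets (borel :: real measure)}"
    have bD: "integrable lborel (\<lambda>p. indicator D p * b n p)" if "D \<in> sets borel" for D
      using integrable_mult_indicator[OF _ b, of D n] that by simp
    have full: "(\<integral>p. b n p \<partial>lborel) = 0"
      unfolding b_def by (intro zero I)
    have sets: "sets borel = sigma_sets (UNIV \<times> UNIV) ?G"
      unfolding borel_prod[symmetric] sets_pair_measure by simp
    have G: "?G \<subseteq> Pow (UNIV \<times> UNIV)" by simp
    have "D \<in> sigma_sets (UNIV \<times> UNIV) ?G" using that sets by simp
    with Int_stable_pair_measure_generator[of borel borel] G show ?thesis
    proof (induction rule: sigma_sets_induct_disjoint)
      case (basic D)
      then obtain S T where D: "D = S \<times> T" "S \<in> sets borel" "T \<in> sets borel" by blast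
      have "(\<integral>p. indicator ((S \<inter> I n) \<times> (T \<inter> I n)) p * a p \<partial>lborel) = 0"
        using D I[of n] by (intro zero) (auto intro: bounded_subset)
      moreover have "indicator ((S \<inter> I n) \<times> (T \<inter> I n)) p * a p = indicator D p * b n p" for p
        by (auto simp: D b_def indicator_def)
      ultimately show ?case by simp
    next
      case (compl D)
      then have "D \<in> sets borel" using sets by simp
      then have "(\<integral>p. b n p - indicator D p * b n p \<partial>lborel) = 0"
        using full compl.IH b bD by simp
      moreover have "indicator (UNIV \<times> UNIV - D) p * b n p = b n p - indicator D p * b n p" for p
        by (auto simp: indicator_def)
      ultimately show ?case by simp
    next
      case (union D)
      then have m [measurable]: "D i \<in> sets borel" for i using sets by auto
      have "(\<integral>p\<in>(\<Union>i. D i). b n p \<partial>lborel) = (\<Sum>i. \<integral>p\<in>D i. b n p \<partial>lborel)"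
        using m union.hyps(1) b
        by (intro lebesgue_integral_countable_add)
          (auto simp: disjoint_family_on_def set_integrable_def intro!: bD)
      then show ?case using union.IH by (simp add: set_lebesgue_integral_def)
    qed (auto)
  qed
  have "AE p in lborel. b n p = 0" for n
    using D[of _ n] b by (intro density_unique_real) (auto simp: set_lebesgue_integral_def)
  then have "AE p in lborel. \<forall>n. b n p = 0" by (simp add: AE_all_countable)
  then show ?thesis
  proof eventually_elim
    case (elim p)
    obtain n where "max \<bar>fst p\<bar> \<bar>snd p\<bar> \<le> real n" using real_arch_simple by blast
    then have "p \<in> I n \<times> I n" by (cases p) (auto simp: I_def)
    then show ?case using elim[rule_format, of n] by (simp add: b_def)
  qed
qed

text \<open>Applying the operator to indicator functions and pairing with indicator functions gives the
  integrals of its kernel over rectangles.\<close>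

lemma hs_eq_0I:
  assumes "\<And>F. hs_apply A F = 0"
  shows "A = 0"
proof -
  obtain a where a: "represents a A" using represents_rep by metis
  have "AE p in lborel. a p = 0"
  proof (rule AE_zero_if_rectangle_integrals_zero[OF represents_square_integrable[OF a]])
    fix S T :: "real set" assume "S \<in> sets borel" "bounded S" "T \<in> sets borel" "bounded T"
    then have r: "represents (indicator S) (abs_l2 (indicator S))"
      "represents (indicator T) (abs_l2 (indicator T))"
      by (auto intro: represents_abs square_integrable_indicator)
    have "inner A (rank_one (abs_l2 (indicator S)) (abs_l2 (indicator T))) = 0"
      by (simp add: inner_rank_one assms)
    then show "(\<integral>p. indicator (S \<times> T) p * a p \<partial>lborel) = 0"
      unfolding inner_represents[OF a represents_rank_one[OF r]]
      by (simp add: indicator_times case_prod_unfold mult.commute)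
  qed
  then show ?thesis
    using represents_eq_iff[OF a represents_zero] by simp
qed

text \<open>Many identities between operators below are tested against vectors, where rank one operators
  and adjoints make them identities between inner products.\<close>

lemma inner_eqI: "(\<And>z. inner x z = inner y z) \<Longrightarrow> x = (y :: 'a::real_inner)"
  by (metis inner_diff_left inner_eq_zero_iff right_minus_eq)

lemma hs_apply_add_left: "hs_apply (A + B) F = hs_apply A F + hs_apply B F"
  by (rule inner_eqI) (simp add: inner_rank_one[symmetric] inner_commute[of _ "_ :: real l2"] inner_add_left inner_add_right)

lemma hs_apply_diff_left: "hs_apply (A - B) F = hs_apply A F - hs_apply B F"
  by (rule inner_eqI) (simp add: inner_rank_one[symmetric] inner_commute[of _ "_ :: real l2"] inner_diff_left inner_diff_right)

lemma hs_apply_scaleR_left: "hs_apply (c *\<^sub>R A) F = c *\<^sub>R hs_apply A F"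
  by (rule inner_eqI) (simp add: inner_rank_one[symmetric] inner_commute[of _ "_ :: real l2"])

lemma hs_ext: "(\<And>F. hs_apply A F = hs_apply B F) \<Longrightarrow> A = B"
  using hs_eq_0I[of "A - B"] by (simp add: hs_apply_diff_left)

lemma hs_transpose_hs_transpose [simp]: "hs_transpose (hs_transpose A) = A"
proof -
  obtain a where a: "represents a A" using represents_rep by metis
  show ?thesis
    using represents_eq_iff[OF represents_hs_transpose[OF represents_hs_transpose[OF a]] a] by simp
qed

lemma inner_hs_transpose: "inner (hs_transpose A) B = inner A (hs_transpose B)"
proof -
  obtain a b where r: "represents a A" "represents b B" using represents_rep by metis
  have [measurable]: "a \<in> borel_measurable (borel \<Otimes>\<^sub>M borel)" "b \<in> borel_measurable (borel \<Otimes>\<^sub>M borel)"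
    using r by (auto intro: square_integrable_pairD represents_square_integrable)
  have "(\<integral>(x, y). a (y, x) * b (x, y) \<partial>(lborel \<Otimes>\<^sub>M lborel))
      = (\<integral>p. (case p of (x, y) \<Rightarrow> a (x, y) * b (y, x)) \<partial>(lborel \<Otimes>\<^sub>M lborel))"
    using lborel_pair.integral_product_swap[of "\<lambda>(x, y). a (x, y) * b (y, x)"]
    by (simp add: case_prod_unfold)
  then show ?thesis
    using inner_represents[OF represents_hs_transpose[OF r(1)] r(2)]
      inner_represents[OF r(1) represents_hs_transpose[OF r(2)]]
    by (simp add: lborel_prod case_prod_unfold)
qed

lemma inner_upper: "inner (upper A) B = inner A (upper B)"
proof -
  obtain a b where r: "represents a A" "represents b B" using represents_rep by metis
  show ?thesis
    using inner_represents[OF represents_upper[OF r(1)] r(2)]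
      inner_represents[OF r(1) represents_upper[OF r(2)]]
    by (simp add: mult.left_commute mult.assoc)
qed

lemma hs_transpose_rank_one: "hs_transpose (rank_one G F) = rank_one F G"
proof -
  obtain g f where r: "represents g G" "represents f F" using represents_rep by metis
  show ?thesis
    using represents_eq_iff[OF represents_hs_transpose[OF represents_rank_one[OF r]]
        represents_rank_one[OF r(2,1)]]
    by (simp add: case_prod_unfold mult.commute)
qed

lemma hs_apply_rank_one: "hs_apply (rank_one G F) H = inner F H *\<^sub>R G"
proof -
  obtain g f h where r: "represents g G" "represents f F" "represents h H"
    using represents_rep by metis
  show ?thesis
    using represents_eq_iff[OF represents_apply[OF represents_rank_one[OF r(1,2)] r(3)]
        represents_scaleR[OF r(1)], of "inner F H"] inner_represents[OF r(2,3)]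
    by (simp add: mult.assoc mult.commute[of _ "g _"])
qed

lemma inner_hs_apply_transpose: "inner (hs_apply (hs_transpose A) F) G = inner F (hs_apply A G)"
  using inner_hs_transpose[of A "rank_one G F"]
  by (simp add: inner_rank_one hs_transpose_rank_one inner_commute)

text \<open>The orthonormal basis of the Hilbert-Schmidt operators made of the rank one operators
  \<open>e \<otimes> f\<close> turns Parseval's identity into the trace formula for the inner product: summing over
  \<open>e\<close> first leaves the sum over \<open>f\<close> of \<open>(Af, Bf)\<close>.\<close>

lemma inner_has_sum_basis:
  assumes E: "orthonormal_basis E"
  shows "((\<lambda>e. inner (hs_apply A e) (hs_apply B e)) has_sum inner A B) E"
proof -
  \<comment> \<open>the argument \<open>f\<close> comes first in the pair because the sum over \<open>e\<close> is to be carried out first\<close>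
  let ?t = "\<lambda>(f, e). rank_one e f"
  have E': "\<And>e. e \<in> E \<Longrightarrow> norm e = 1" "pairwise orthogonal E" "closure (span E) = UNIV"
    using E by (auto simp: orthonormal_basis_def)
  have t: "inner (rank_one e f) (rank_one e' f') = inner e e' * inner f f'" for e f e' f'
    by (simp add: inner_rank_one hs_apply_rank_one inner_commute)
  have n: "norm (rank_one e f) = norm e * norm f" for e f
    by (simp add: norm_eq_sqrt_inner t real_sqrt_mult)
  have on: "inner e e' = (if e = e' then 1 else 0)" if "e \<in> E" "e' \<in> E" for e e'
    using E' that by (auto simp: pairwise_def orthogonal_def dot_square_norm)
  have inj: "inj_on ?t (E \<times> E)"
  proof (rule inj_onI, clarify)
    fix f e f' e' assume m: "f \<in> E" "e \<in> E" "f' \<in> E" "e' \<in> E" and eq: "rank_one e f = rank_one e' f'"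
    have "inner (rank_one e f) (rank_one e' f') = 1"
      unfolding eq t using m by (simp add: on)
    then show "f = f' \<and> e = e'" unfolding t using m by (auto simp: on split: if_splits)
  qed
  have zero: "inner v w = 0" if "\<And>e. e \<in> E \<Longrightarrow> inner e w = 0" for v w :: "real l2"
  proof -
    have "span E \<subseteq> {v. inner v w = 0}"
      using that by (intro span_minimal) (auto simp: subspace_def inner_add_left)
    moreover have "closed {v. inner v w = 0}" by (intro closed_Collect_eq continuous_intros)
    ultimately show ?thesis using E'(3) closure_minimal by blast
  qed
  have "orthonormal_basis (?t ` (E \<times> E))"
    unfolding orthonormal_basis_def
  proof (intro conjI ballI)
    show "norm u = 1" if "u \<in> ?t ` (E \<times> E)" for u
      using that E' by (auto simp: n)
    show "pairwise orthogonal (?t ` (E \<times> E))"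
      by (auto simp: pairwise_def orthogonal_def t on)
    show "closure (span (?t ` (E \<times> E))) = UNIV"
    proof (rule closure_span_eq_UNIV, rule hs_eq_0I)
      fix C F assume C: "\<And>s. s \<in> ?t ` (E \<times> E) \<Longrightarrow> inner C s = 0"
      have "inner (hs_apply C f) g = 0" if "f \<in> E" for f g
      proof -
        have "inner g (hs_apply C f) = 0"
        proof (rule zero)
          fix e assume "e \<in> E"
          then show "inner e (hs_apply C f) = 0"
            using C[of "rank_one e f"] that by (force simp: inner_rank_one)
        qed
        then show ?thesis by (simp add: inner_commute)
      qed
      then have "inner f (hs_apply (hs_transpose C) g) = 0" if "f \<in> E" for f g
        using inner_hs_apply_transpose[of "hs_transpose C"] that by simp
      then have "inner F (hs_apply (hs_transpose C) g) = 0" for g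
        by (rule zero)
      then have "inner (hs_apply C F) g = 0" for g
        using inner_hs_apply_transpose[of "hs_transpose C"] by simp
      then show "hs_apply C F = 0" using inner_eq_zero_iff by blast
    qed
  qed
  from parseval[OF this, of A B]
  have "((\<lambda>p. inner A (?t p) * inner B (?t p)) has_sum inner A B) (E \<times> E)"
    using has_sum_reindex[OF inj, of "\<lambda>u. inner A u * inner B u"] by (simp add: o_def)
  then show ?thesis
  proof (rule has_sum_SigmaD)
    fix f assume "f \<in> E"
    show "((\<lambda>e. inner A (?t (f, e)) * inner B (?t (f, e))) has_sum
        inner (hs_apply A f) (hs_apply B f)) E"
      using parseval[OF E, of "hs_apply A f" "hs_apply B f"] by (simp add: inner_rank_one inner_commute)
  qed
qed

lemma hs_pairing_eq_inner: "hs_pairing A B = inner A (hs_transpose B)"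
  by transfer (simp add: case_prod_unfold)

lemma hs_pairing_has_sum:
  assumes "orthonormal_basis E"
  shows "((\<lambda>e. inner e (hs_apply (A \<odot> B) e)) has_sum hs_pairing A B) E"
proof -
  have "hs_pairing A B = inner (hs_transpose A) B" by (simp add: hs_pairing_eq_inner inner_hs_transpose)
  then show ?thesis
    using inner_has_sum_basis[OF assms, of "hs_transpose A" B]
    by (simp add: inner_hs_apply_transpose hs_apply_comp)
qed

text \<open>The description operator in the trace needs an orthonormal basis to exist: with none, every
  number would satisfy its defining property.\<close>

lemma hs_trace_comp: "hs_trace (A \<odot> B) = hs_pairing A B"
  unfolding hs_trace_def
proof (rule the_equality)
  show "\<forall>E. orthonormal_basis E \<longrightarrow> ((\<lambda>e. inner e (hs_apply (A \<odot> B) e)) has_sum hs_pairing A B) E"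
    using hs_pairing_has_sum by blast
  fix s assume s: "\<forall>E. orthonormal_basis E \<longrightarrow> ((\<lambda>e. inner e (hs_apply (A \<odot> B) e)) has_sum s) E"
  obtain E :: "real l2 set" where E: "orthonormal_basis E" using ex_orthonormal_basis by blast
  show "s = hs_pairing A B"
    using s E hs_pairing_has_sum[OF E] has_sum_unique by blast
qed

lemma hs_comp_assoc: "(A \<odot> B) \<odot> C = A \<odot> (B \<odot> C)"
  by (rule hs_ext) (simp add: hs_apply_comp)

lemma hs_transpose_comp: "hs_transpose (A \<odot> B) = hs_transpose B \<odot> hs_transpose A"
  by (rule hs_ext, rule inner_eqI) (simp add: inner_hs_apply_transpose hs_apply_comp)

lemma norm_hs_transpose [simp]: "norm (hs_transpose A) = norm A"
  by (simp add: norm_eq_sqrt_inner inner_hs_transpose)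

lemma bounded_linear_hs_transpose: "bounded_linear hs_transpose"
proof (rule bounded_linear_intro)
  show "hs_transpose (A + B) = hs_transpose A + hs_transpose B" for A B
    by (rule inner_eqI) (simp add: inner_hs_transpose inner_add_left)
  show "hs_transpose (c *\<^sub>R A) = c *\<^sub>R hs_transpose A" for c A
    by (rule inner_eqI) (simp add: inner_hs_transpose)
  show "norm (hs_transpose A) \<le> norm A * 1" for A by simp
qed

lemmas hs_transpose_linear_simps =
  linear_add[OF bounded_linear.linear[OF bounded_linear_hs_transpose]]
  linear_diff[OF bounded_linear.linear[OF bounded_linear_hs_transpose]]
  linear_neg[OF bounded_linear.linear[OF bounded_linear_hs_transpose]]
  linear_cmul[OF bounded_linear.linear[OF bounded_linear_hs_transpose]]

text \<open>The norm estimate sums the pointwise bound \<open>norm (A (B e)) \<le> norm A * norm (B e)\<close> over an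
  orthonormal basis.\<close>

lemma bounded_bilinear_comp: "bounded_bilinear (\<odot>)"
proof
  fix A A' B B' :: hs and c :: real
  have c: "hs_transpose (hs_transpose B \<odot> hs_transpose A) = A \<odot> B" for A B by (simp add: hs_transpose_comp)
  show l: "(A + A') \<odot> B = A \<odot> B + A' \<odot> B" for A A' B
    by (rule hs_ext) (simp add: hs_apply_comp hs_apply_add_left)
  show ls: "(c *\<^sub>R A) \<odot> B = c *\<^sub>R (A \<odot> B)" for A B
    by (rule hs_ext) (simp add: hs_apply_comp hs_apply_scaleR_left)
  show "A \<odot> (B + B') = A \<odot> B + A \<odot> B'"
    unfolding c[symmetric, of A] hs_transpose_linear_simps l ..
  show "A \<odot> (c *\<^sub>R B) = c *\<^sub>R (A \<odot> B)"
    unfolding c[symmetric, of A] hs_transpose_linear_simps ls ..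
next
  have op: "norm (hs_apply A F) \<le> norm A * norm F" for A F
  proof -
    \<comment> \<open>the rank one operator that tests \<open>A F\<close> against itself\<close>
    let ?G = "hs_apply A F"
    have "norm (rank_one ?G F) = norm ?G * norm F"
      by (simp add: norm_eq_sqrt_inner inner_rank_one hs_apply_rank_one real_sqrt_mult)
    then have "norm ?G * norm ?G \<le> norm ?G * (norm A * norm F)"
      using Cauchy_Schwarz_ineq2[of A "rank_one ?G F"]
      by (simp add: inner_rank_one dot_square_norm power2_eq_square mult_ac)
    then show ?thesis
      by (cases "norm ?G = 0") (auto simp: mult_le_cancel_left)
  qed
  obtain E :: "real l2 set" where E: "orthonormal_basis E" using ex_orthonormal_basis by blast
  have "norm (A \<odot> B) \<le> norm A * norm B * 1" for A B
  proof -
    have "inner (A \<odot> B) (A \<odot> B) \<le> (norm A)\<^sup>2 * inner B B"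
    proof (rule has_sum_mono[OF inner_has_sum_basis[OF E] has_sum_cmult_right[OF inner_has_sum_basis[OF E]]])
      fix e
      show "inner (hs_apply (A \<odot> B) e) (hs_apply (A \<odot> B) e)
          \<le> (norm A)\<^sup>2 * inner (hs_apply B e) (hs_apply B e)"
        using power_mono[OF op[of A "hs_apply B e"], of 2]
        by (simp add: hs_apply_comp power_mult_distrib power2_norm_eq_inner)
    qed
    then have "(norm (A \<odot> B))\<^sup>2 \<le> (norm A * norm B)\<^sup>2"
      by (simp add: power2_norm_eq_inner power_mult_distrib)
    then have "norm (A \<odot> B) \<le> norm A * norm B" by (rule power2_le_imp_le) simp
    then show ?thesis by simp
  qed
  then show "\<exists>K. \<forall>A B. norm (A \<odot> B) \<le> norm A * norm B * K" by blast
qed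

interpretation comp: bounded_bilinear "(\<odot>)" by (rule bounded_bilinear_comp)

lemma bounded_bilinear_pairing: "bounded_bilinear hs_pairing"
  unfolding hs_pairing_eq_inner[abs_def]
  by (rule bounded_bilinear.comp[OF bounded_bilinear_inner bounded_linear_ident bounded_linear_hs_transpose])

interpretation pairing: bounded_bilinear hs_pairing by (rule bounded_bilinear_pairing)

lemma pairing_commute: "hs_pairing A B = hs_pairing B A"
  unfolding hs_pairing_eq_inner by (metis inner_commute inner_hs_transpose)

text \<open>Both sides are the trace of the triple product. Together with the symmetry of the pairing this
  is the cyclicity of the trace.\<close>

lemma pairing_comp_assoc: "hs_pairing (A \<odot> B) C = hs_pairing A (B \<odot> C)"
  by (simp add: hs_trace_comp[symmetric] hs_comp_assoc)

lemma pairing_eqI: "(\<And>C. hs_pairing C A = hs_pairing C B) \<Longrightarrow> A = B"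
proof (rule inner_eqI)
  fix C
  assume "\<And>C. hs_pairing C A = hs_pairing C B"
  from this[of "hs_transpose C"] show "inner A C = inner B C"
    by (simp add: hs_pairing_eq_inner inner_hs_transpose inner_commute)
qed

text \<open>Invariance of the pairing under the adjoint action.\<close>

lemma pairing_lie: "hs_pairing K (lie A B) = hs_pairing A (lie B K)"
  unfolding lie_def pairing.diff_right pairing_comp_assoc[symmetric]
  by (metis pairing_commute pairing_comp_assoc)

section \<open>The splitting into Volterra and skew operators\<close>

lemma is_adjoint_iff: "is_adjoint A B \<longleftrightarrow> B = hs_transpose A"
proof
  assume A: "is_adjoint A B"
  have eq: "inner f (hs_apply B g) = inner f (hs_apply (hs_transpose A) g)" for f g
    using A[unfolded is_adjoint_def, rule_format, of f g]
      inner_hs_apply_transpose[of "hs_transpose A" f g, unfolded hs_transpose_hs_transpose] by (rule trans[OF sym])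
  have "hs_apply B g = hs_apply (hs_transpose A) g" for g
    by (rule inner_eqI) (simp add: eq inner_commute[of "hs_apply _ g"])
  then show "B = hs_transpose A" by (rule hs_ext)
next
  assume "B = hs_transpose A"
  then show "is_adjoint A B"
    using inner_hs_apply_transpose[of "hs_transpose A", unfolded hs_transpose_hs_transpose]
    unfolding is_adjoint_def by blast
qed

lemma selfadjoint_ops_iff: "K \<in> selfadjoint_ops \<longleftrightarrow> hs_transpose K = K"
  by (auto simp: selfadjoint_ops_def is_adjoint_iff)

lemma skew_ops_iff: "B \<in> skew_ops \<longleftrightarrow> hs_transpose B = - B"
  by (auto simp: skew_ops_def is_adjoint_iff)

lemma upper_diff: "upper (A - B) = upper A - upper B"
  by (rule inner_eqI) (simp add: inner_upper inner_diff_left)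

lemma upper_scaleR: "upper (c *\<^sub>R A) = c *\<^sub>R upper A"
  by (rule inner_eqI) (simp add: inner_upper)

lemma hs_transpose_zero [simp]: "hs_transpose 0 = 0"
  by (rule linear_0[OF bounded_linear.linear[OF bounded_linear_hs_transpose]])

lemma upper_zero [simp]: "upper 0 = 0"
  using upper_scaleR[of 0 0] by simp

lemma AE_off_diagonal: "AE p in (lborel :: (real \<times> real) measure). fst p \<noteq> snd p"
proof -
  have "AE p in lborel \<Otimes>\<^sub>M lborel. fst p \<noteq> (snd p :: real)"
  proof (rule lborel_pair.AE_pair_measure)
    show "AE x in lborel. AE y in lborel. fst (x, y) \<noteq> (snd (x, y) :: real)"
      using AE_lborel_singleton by (auto simp: eq_commute)
  qed measurable
  then show ?thesis unfolding lborel_prod .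
qed

text \<open>The diagonal is a null set, so a kernel is the sum of its parts above and below it.\<close>

lemma upper_plus_lower: "upper A + hs_transpose (upper (hs_transpose A)) = A"
proof -
  obtain a where a: "represents a A" using represents_rep by metis
  have "AE p in lborel. indicator {(x, y). x < y} p * a p +
      (case p of (x, y) \<Rightarrow> indicator {(x, y). x < y} (y, x) * (case (y, x) of (x, y) \<Rightarrow> a (y, x))) = a p"
    using AE_off_diagonal by eventually_elim (auto simp: indicator_def)
  then show ?thesis
    using represents_eq_iff[OF represents_add[OF represents_upper[OF a]
        represents_hs_transpose[OF represents_upper[OF represents_hs_transpose[OF a]]]] a] by simp
qed

lemma upper_upper [simp]: "upper (upper A) = upper A"
proof -
  obtain a where a: "represents a A" using represents_rep by metis
  show ?thesis
    using represents_eq_iff[OF represents_upper[OF represents_upper[OF a]] represents_upper[OF a]]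
    by (simp add: indicator_def)
qed

lemma upper_transpose_upper [simp]: "upper (hs_transpose (upper A)) = 0"
proof -
  obtain a where a: "represents a A" using represents_rep by metis
  show ?thesis
    using represents_eq_iff[OF represents_upper[OF represents_hs_transpose[OF represents_upper[OF a]]]
        represents_zero]
    by (simp add: indicator_def case_prod_unfold)
qed

lemma volterra_ops_iff: "A \<in> volterra_ops \<longleftrightarrow> upper A = 0"
proof
  assume "A \<in> volterra_ops"
  then obtain a where a: "represents a A" "\<forall>x y. x < y \<longrightarrow> a (x, y) = 0"
    by (auto simp: volterra_ops_def)
  then have "indicator {(x, y). x < y} p * a p = 0" for p
    by (auto simp: indicator_def)
  then show "upper A = 0"
    using represents_eq_iff[OF represents_upper[OF a(1)] represents_zero] by simp
next
  assume u: "upper A = 0"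
  obtain a where a: "represents a A" using represents_rep by metis
  have "represents (\<lambda>p. a p - indicator {(x, y). x < y} p * a p) A"
    using represents_diff[OF a represents_upper[OF a]] u by simp
  then show "A \<in> volterra_ops"
    unfolding volterra_ops_def by (intro CollectI exI conjI) (auto simp: indicator_def)
qed

text \<open>The sum of the Volterra and the skew operators is direct.\<close>

lemma skew_volterra_eq_0:
  assumes "upper A = 0" "hs_transpose A = - A"
  shows "A = 0"
  using upper_plus_lower[of A] assms upper_scaleR[of "-1" A] by (simp add: hs_transpose_linear_simps)

text \<open>The skew part is forced above the diagonal, where the Volterra part vanishes, and extended
  below it by antisymmetry.\<close>

lemma proj_skew_eq: "proj_skew A = upper A - hs_transpose (upper A)"
proof -
  define B\<^sub>0 where "B\<^sub>0 = upper A - hs_transpose (upper A)"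
  have B\<^sub>0: "hs_transpose B\<^sub>0 = - B\<^sub>0" "upper (A - B\<^sub>0) = 0"
    by (simp_all add: B\<^sub>0_def hs_transpose_linear_simps upper_diff)
  have uniq: "B = B\<^sub>0" if B: "hs_transpose B = - B \<and> upper (A - B) = 0" for B
  proof -
    have "upper ((A - B) - (A - B\<^sub>0)) = 0"
      unfolding upper_diff[of "A - B"] using B B\<^sub>0(2) by simp
    then have "upper (B\<^sub>0 - B) = 0" by simp
    moreover have "hs_transpose (B\<^sub>0 - B) = - (B\<^sub>0 - B)"
      unfolding hs_transpose_linear_simps(2) using B B\<^sub>0(1) by simp
    ultimately have "B\<^sub>0 - B = 0" by (rule skew_volterra_eq_0)
    then show ?thesis by simp
  qed
  have "proj_skew A = B\<^sub>0"
    unfolding proj_skew_def skew_ops_iff volterra_ops_iff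
    using B\<^sub>0 uniq by (intro the_equality conjI)
  then show ?thesis by (simp add: B\<^sub>0_def)
qed

lemma proj_skew_transpose: "hs_transpose (proj_skew A) = - proj_skew A"
  by (simp add: proj_skew_eq hs_transpose_linear_simps)

lemma proj_skew_scaleR: "proj_skew (c *\<^sub>R A) = c *\<^sub>R proj_skew A"
  by (simp add: proj_skew_eq upper_scaleR hs_transpose_linear_simps scaleR_right_diff_distrib)

lemma proj_volterra_eq: "proj_volterra A = A - proj_skew A"
proof -
  have upper: "upper (A - proj_skew A) = 0"
    by (simp add: proj_skew_eq upper_diff)
  have skew: "hs_transpose (A - (A - proj_skew A)) = - (A - (A - proj_skew A))"
    by (simp add: proj_skew_transpose)
  have uniq: "L = A - proj_skew A" if L: "upper L = 0 \<and> hs_transpose (A - L) = - (A - L)" for L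
  proof -
    have "upper ((A - proj_skew A) - L) = 0"
      using L by (simp add: proj_skew_eq upper_diff)
    moreover have "hs_transpose ((A - L) - proj_skew A) = - ((A - L) - proj_skew A)"
      unfolding hs_transpose_linear_simps(2)[of "A - L"] L[THEN conjunct2] proj_skew_transpose by simp
    then have "hs_transpose ((A - proj_skew A) - L) = - ((A - proj_skew A) - L)"
      by (simp add: diff_diff_eq add.commute)
    ultimately have "(A - proj_skew A) - L = 0" by (rule skew_volterra_eq_0)
    then show ?thesis by simp
  qed
  show ?thesis
    unfolding proj_volterra_def skew_ops_iff volterra_ops_iff
    using upper skew uniq by (intro the_equality conjI)
qed

text \<open>The adjoint of \<open>proj_volterra\<close> with respect to the pairing. Its range consists of
  selfadjoint operators, the annihilator of the skew ones.\<close>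

definition reflect_upper :: "hs \<Rightarrow> hs" where
  "reflect_upper C = upper C + hs_transpose (upper C)"

lemma reflect_upper_selfadjoint: "hs_transpose (reflect_upper C) = reflect_upper C"
  by (simp add: reflect_upper_def hs_transpose_linear_simps)

text \<open>Cutting a kernel off to one side of the diagonal is a symmetric operation for the inner
  product; carrying the transpositions along gives the adjoint for the pairing.\<close>

lemma pairing_proj_skew: "hs_pairing (proj_skew A) C = hs_pairing A (C - reflect_upper C)"
proof -
  have "hs_pairing A C = inner A (hs_transpose (upper C) + upper (hs_transpose C))"
    using upper_plus_lower[of "hs_transpose C"] by (simp add: hs_pairing_eq_inner add.commute)
  moreover have "hs_pairing (proj_skew A) C = inner A (upper (hs_transpose C)) - inner A (upper C)"
    by (simp add: hs_pairing_eq_inner proj_skew_eq inner_diff_left inner_upper inner_hs_transpose)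
  moreover have "hs_pairing A (reflect_upper C) = inner A (upper C) + inner A (hs_transpose (upper C))"
    by (simp add: hs_pairing_eq_inner reflect_upper_selfadjoint)
      (simp add: reflect_upper_def inner_add_right)
  ultimately show ?thesis by (simp add: pairing.diff_right inner_add_right)
qed

lemma lie_anti: "lie A B = - lie B A"
  by (simp add: lie_def)

lemma lie_diff_left: "lie (A - B) C = lie A C - lie B C"
  by (simp add: lie_def comp.diff_left comp.diff_right)

lemma lie_scaleR_left: "lie (c *\<^sub>R A) B = c *\<^sub>R lie A B"
  by (simp add: lie_def comp.scaleR_left comp.scaleR_right scaleR_right_diff_distrib)

lemma r_op_eq: "r_op A = A - 2 *\<^sub>R proj_skew A"
  by (simp add: r_op_def proj_volterra_eq scaleR_2)

lemma lie_R_anti: "lie_R A B = - lie_R B A"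
  unfolding lie_R_def lie_anti[of A] lie_anti[of "r_op A"] by (simp add: algebra_simps)

text \<open>The velocity at \<open>K\<close> of the Hamiltonian flow of a function with gradient \<open>B\<close>.\<close>

definition ham_vec :: "hs \<Rightarrow> hs \<Rightarrow> hs" where
  "ham_vec B K = reflect_upper (lie B K) - lie (proj_skew B) K"

text \<open>Writing \<open>R = 1 - 2 proj_skew\<close>, the invariance of the pairing moves \<open>A\<close> out of both brackets.
  The projection that is applied to \<open>A\<close> moves over to \<open>[B, K]\<close> as its adjoint, and what is left of
  \<open>[B, K]\<close> is its image under the adjoint of \<open>proj_volterra\<close>.\<close>

lemma pairing_lie_R: "hs_pairing K (lie_R A B) = hs_pairing A (ham_vec B K)"
proof -
  let ?C = "lie B K"
  have "hs_pairing K (lie (r_op A) B) = hs_pairing A ?C - 2 * hs_pairing A (?C - reflect_upper ?C)"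
    unfolding pairing_lie[of K "r_op A"] by (simp add: r_op_eq pairing.diff_left
        pairing.scaleR_left pairing_proj_skew)
  moreover have "hs_pairing K (lie A (r_op B)) = hs_pairing A ?C - 2 * hs_pairing A (lie (proj_skew B) K)"
    unfolding pairing_lie[of K A] by (simp add: r_op_eq lie_diff_left lie_scaleR_left
        pairing.diff_right pairing.scaleR_right)
  ultimately show ?thesis
    by (simp add: lie_R_def ham_vec_def pairing.scaleR_right pairing.add_right pairing.diff_right)
qed

text \<open>Commutators of a skew with a selfadjoint operator are selfadjoint, so all Hamiltonian
  velocities at selfadjoint operators are.\<close>

lemma ham_vec_selfadjoint:
  assumes "K \<in> selfadjoint_ops"
  shows "ham_vec B K \<in> selfadjoint_ops"
proof -
  have "hs_transpose (lie (proj_skew B) K) = lie (proj_skew B) K"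
    using assms by (simp add: selfadjoint_ops_iff lie_def hs_transpose_linear_simps hs_transpose_comp
        proj_skew_transpose comp.minus_left comp.minus_right)
  then show ?thesis
    by (simp add: selfadjoint_ops_iff ham_vec_def hs_transpose_linear_simps reflect_upper_selfadjoint)
qed

text \<open>An operator \<open>B\<close> that commutes with \<open>K\<close> contributes only through its skew part, or equally
  through its Volterra part: the Lax form of the equations of motion.\<close>

lemma ham_vec_commuting:
  assumes "lie B K = 0"
  shows "ham_vec (c *\<^sub>R B) K = c *\<^sub>R lie (proj_volterra B) K"
  using assms by (simp add: ham_vec_def lie_scaleR_left reflect_upper_def proj_skew_scaleR
      proj_volterra_eq lie_diff_left hs_transpose_linear_simps)

section \<open>Smooth functions and gradients\<close>

text \<open>Iterated derivatives on an open set are local, which allows replacing a derivative by any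
  formula for it that is valid on the set.\<close>

lemma times_differentiable_on_cong:
  assumes "open U" "\<And>x. x \<in> U \<Longrightarrow> f x = g x" "times_differentiable_on k U f"
  shows "times_differentiable_on k U g"
  using assms(2,3)
proof (induction k arbitrary: f g)
  case 0
  then show ?case by (simp cong: continuous_on_cong)
next
  case (Suc k)
  have D: "(g has_derivative frechet_derivative f (at x)) (at x)" if "x \<in> U" for x
  proof (rule has_derivative_transform_within_open[OF _ assms(1) that])
    show "(f has_derivative frechet_derivative f (at x)) (at x)"
      using Suc.prems(2) that by (simp add: frechet_derivative_works)
  qed (use Suc.prems(1) in auto)
  then have eq: "frechet_derivative f (at x) v = frechet_derivative g (at x) v" if "x \<in> U" for x v
    using frechet_derivative_at that by metis
  have "times_differentiable_on k U (\<lambda>x. frechet_derivative g (at x) v)" for v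
    by (rule Suc.IH[of "\<lambda>x. frechet_derivative f (at x) v"]) (use eq Suc.prems(2) in auto)
  then show ?case using D by (auto simp: differentiable_def)
qed

lemma times_differentiable_on_SucI:
  assumes "open U" "\<And>x. x \<in> U \<Longrightarrow> (f has_derivative f' x) (at x)"
    "\<And>v. times_differentiable_on k U (\<lambda>x. f' x v)"
  shows "times_differentiable_on (Suc k) U f"
proof -
  have eq: "f' x v = frechet_derivative f (at x) v" if "x \<in> U" for x v
    using assms(2)[OF that] frechet_derivative_at by metis
  have "times_differentiable_on k U (\<lambda>x. frechet_derivative f (at x) v)" for v
    by (rule times_differentiable_on_cong[OF assms(1) _ assms(3)[of v]]) (use eq in auto)
  then show ?thesis using assms(2) by (auto simp: differentiable_def)
qed

lemma times_differentiable_on_Suc_has_derivative: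
  "times_differentiable_on (Suc k) U f \<Longrightarrow> x \<in> U \<Longrightarrow>
    (f has_derivative frechet_derivative f (at x)) (at x)"
  by (simp add: frechet_derivative_works)

lemma times_differentiable_on_SucD:
  "times_differentiable_on (Suc k) U f \<Longrightarrow> times_differentiable_on k U f"
proof (induction k arbitrary: f)
  case 0
  then show ?case
    by (auto intro!: continuous_at_imp_continuous_on differentiable_imp_continuous_within)
qed simp

lemma times_differentiable_on_const:
  fixes c :: "'b::real_normed_vector"
  assumes "open U" shows "times_differentiable_on k U (\<lambda>x. c)"
proof (induction k arbitrary: c)
  case (Suc k)
  then show ?case
    by (intro times_differentiable_on_SucI[OF assms, of _ "\<lambda>x v. 0"]) auto
qed simp

lemma times_differentiable_on_bounded_linear:
  assumes "open U" "bounded_linear f" shows "times_differentiable_on k U f"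
proof (cases k)
  case 0
  then show ?thesis using assms(2) by (simp add: linear_continuous_on)
next
  case (Suc k')
  then show ?thesis unfolding Suc using assms
    by (intro times_differentiable_on_SucI[of U f "\<lambda>x. f"] times_differentiable_on_const)
      (auto intro: bounded_linear_imp_has_derivative)
qed

lemma times_differentiable_on_add:
  assumes "open U" "times_differentiable_on k U f" "times_differentiable_on k U g"
  shows "times_differentiable_on k U (\<lambda>x. f x + g x)"
  using assms(2,3)
proof (induction k arbitrary: f g)
  case 0
  then show ?case by (simp add: continuous_on_add)
next
  case (Suc k)
  show ?case
  proof (rule times_differentiable_on_SucI[OF assms(1)])
    show "((\<lambda>x. f x + g x) has_derivative
        (\<lambda>v. frechet_derivative f (at x) v + frechet_derivative g (at x) v)) (at x)" if "x \<in> U" for x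
      using Suc.prems that
      by (intro has_derivative_add times_differentiable_on_Suc_has_derivative)
  qed (use Suc in auto)
qed

text \<open>The product rule expresses the derivative through products of functions that have one
  derivative fewer.\<close>

lemma times_differentiable_on_bilinear:
  assumes "open U" "bounded_bilinear p" "times_differentiable_on k U f" "times_differentiable_on k U g"
  shows "times_differentiable_on k U (\<lambda>x. p (f x) (g x))"
  using assms(3,4)
proof (induction k arbitrary: f g)
  case 0
  then show ?case by (simp add: bounded_bilinear.continuous_on[OF assms(2)])
next
  case (Suc k)
  show ?case
  proof (rule times_differentiable_on_SucI[OF assms(1)])
    show "((\<lambda>x. p (f x) (g x)) has_derivative
        (\<lambda>v. p (f x) (frechet_derivative g (at x) v) + p (frechet_derivative f (at x) v) (g x))) (at x)"
      if "x \<in> U" for x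
      using Suc.prems that
      by (intro bounded_bilinear.FDERIV[OF assms(2)] times_differentiable_on_Suc_has_derivative)
    show "times_differentiable_on k U
        (\<lambda>x. p (f x) (frechet_derivative g (at x) v) + p (frechet_derivative f (at x) v) (g x))" for v
      using Suc.prems times_differentiable_on_SucD[OF Suc.prems(1)]
        times_differentiable_on_SucD[OF Suc.prems(2)]
      by (intro times_differentiable_on_add assms(1) Suc.IH) auto
  qed
qed

lemma smooth_on_bounded_linear: "open U \<Longrightarrow> bounded_linear f \<Longrightarrow> smooth_on U f"
  by (simp add: smooth_on_def times_differentiable_on_bounded_linear)

lemma smooth_on_const: "open U \<Longrightarrow> smooth_on U (\<lambda>x. c)"
  by (simp add: smooth_on_def times_differentiable_on_const)

lemma smooth_on_add: "open U \<Longrightarrow> smooth_on U f \<Longrightarrow> smooth_on U g \<Longrightarrow> smooth_on U (\<lambda>x. f x + g x)"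
  by (simp add: smooth_on_def times_differentiable_on_add)

lemma smooth_on_bilinear:
  "open U \<Longrightarrow> bounded_bilinear p \<Longrightarrow> smooth_on U f \<Longrightarrow> smooth_on U g \<Longrightarrow>
    smooth_on U (\<lambda>x. p (f x) (g x))"
  by (simp add: smooth_on_def times_differentiable_on_bilinear)

lemma smooth_on_differentiable: "smooth_on U f \<Longrightarrow> x \<in> U \<Longrightarrow> f differentiable (at x)"
  unfolding smooth_on_def using times_differentiable_on.simps(2)[of 0 U f] by blast

text \<open>The pairing is non-degenerate, so the directional derivatives determine the gradient.\<close>

lemma grad_eqI:
  assumes "(F has_derivative hs_pairing A) (at K)"
  shows "grad F K = A"
proof -
  have *: "((\<lambda>t. F (K + t *\<^sub>R K')) has_real_derivative hs_pairing A K') (at 0)" for K'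
  proof -
    have "((\<lambda>t::real. K + t *\<^sub>R K') has_derivative (\<lambda>t. t *\<^sub>R K')) (at 0)"
      by (auto intro!: derivative_eq_intros)
    from has_derivative_compose[OF this, of F "hs_pairing A"] assms
    have "((\<lambda>t. F (K + t *\<^sub>R K')) has_derivative (\<lambda>t. hs_pairing A (t *\<^sub>R K'))) (at 0)"
      by simp
    then show ?thesis
      unfolding has_field_derivative_def pairing.scaleR_right by (simp add: mult_commute_abs)
  qed
  show ?thesis
    unfolding grad_def
  proof (rule the_equality)
    fix B assume B: "\<forall>K'. ((\<lambda>t. F (K + t *\<^sub>R K')) has_real_derivative hs_pairing B K') (at 0)"
    show "B = A"
    proof (rule pairing_eqI)
      fix C
      show "hs_pairing C B = hs_pairing C A"
        using DERIV_unique[OF B[rule_format, of C] *[of C]]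
        by (simp add: pairing_commute[of _ C])
    qed
  qed (use * in blast)
qed

text \<open>Completeness enters here: the derivative is a bounded functional, and the Riesz
  representation theorem turns it into an operator.\<close>

lemma has_derivative_grad:
  assumes "F differentiable (at K)"
  shows "(F has_derivative hs_pairing (grad F K)) (at K)"
proof -
  obtain D where D: "(F has_derivative D) (at K)" using assms by (auto simp: differentiable_def)
  obtain y where y: "\<And>x. D x = inner x y"
    using riesz_representation[OF has_derivative_bounded_linear[OF D]] by blast
  have "D = hs_pairing (hs_transpose y)"
    by (auto simp: y hs_pairing_eq_inner inner_hs_transpose inner_commute)
  then show ?thesis using D grad_eqI by metis
qed

lemma grad_pairing: "grad (hs_pairing A) K = A"
  by (rule grad_eqI) (rule bounded_linear_imp_has_derivative[OF pairing.bounded_linear_right])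

lemma has_real_derivative_along_curve:
  assumes "F differentiable (at (c t))" "(c has_vector_derivative v) (at t)"
  shows "((\<lambda>s. F (c s)) has_real_derivative hs_pairing (grad F (c t)) v) (at t)"
proof -
  have "((\<lambda>s. F (c s)) has_derivative (\<lambda>s. hs_pairing (grad F (c t)) (s *\<^sub>R v))) (at t)"
    using has_derivative_compose[OF assms(2)[unfolded has_vector_derivative_def]
        has_derivative_grad[OF assms(1)]] .
  then show ?thesis
    unfolding has_field_derivative_def pairing.scaleR_right by (simp add: mult_commute_abs)
qed

lemma has_vector_derivative_line: "((\<lambda>s. K + s *\<^sub>R v) has_vector_derivative v) (at t)"
  by (auto intro!: derivative_eq_intros simp: has_vector_derivative_def)

section \<open>Hamiltonian vector fields and the selfadjoint Poisson submanifold\<close>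

lemma poisson_R_eq: "poisson_R F G K = hs_pairing (grad F K) (ham_vec (grad G K) K)"
  by (simp add: poisson_R_def pairing_lie_R)

lemma poisson_R_anti: "poisson_R F G K = - poisson_R G F K"
  unfolding poisson_R_def lie_R_anti[of "grad F K"] by (simp add: pairing.minus_right)

text \<open>Existence is the chain rule. For uniqueness it is enough to test the defining property on
  the linear functions \<open>(A, _)\<close> along straight lines.\<close>

lemma hamiltonian_vf_eq: "hamiltonian_vf H = (\<lambda>K. ham_vec (grad H K) K)"
  unfolding hamiltonian_vf_def
proof (rule the_equality)
  show "is_hamiltonian_vf H (\<lambda>K. ham_vec (grad H K) K)"
    unfolding is_hamiltonian_vf_def poisson_R_eq
    by (intro allI impI has_real_derivative_along_curve) (auto intro: smooth_on_differentiable)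
next
  fix X assume X: "is_hamiltonian_vf H X"
  show "X = (\<lambda>K. ham_vec (grad H K) K)"
  proof (rule ext, rule pairing_eqI)
    fix K A
    let ?c = "\<lambda>s. K + s *\<^sub>R X K"
    have "smooth_on UNIV (hs_pairing A)"
      by (intro smooth_on_bounded_linear pairing.bounded_linear_right) auto
    moreover have c: "(?c has_vector_derivative X K) (at 0)"
      by (rule has_vector_derivative_line)
    ultimately have "((\<lambda>s. hs_pairing A (?c s)) has_real_derivative poisson_R (hs_pairing A) H K) (at 0)"
      using X[unfolded is_hamiltonian_vf_def, rule_format, of "hs_pairing A" ?c 0] by simp
    moreover have "((\<lambda>s. hs_pairing A (?c s)) has_real_derivative hs_pairing A (X K)) (at 0)"
      using has_real_derivative_along_curve[of "hs_pairing A" ?c 0, OF _ c]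
      by (simp add: grad_pairing bounded_linear_imp_differentiable pairing.bounded_linear_right)
    ultimately show "hs_pairing A (X K) = hs_pairing A (ham_vec (grad H K) K)"
      using DERIV_unique by (fastforce simp: poisson_R_eq grad_pairing)
  qed
qed

lemma subspace_selfadjoint_ops: "subspace selfadjoint_ops"
  by (simp add: subspace_def selfadjoint_ops_iff hs_transpose_linear_simps)

lemma line_in_selfadjoint_ops:
  "K \<in> selfadjoint_ops \<Longrightarrow> v \<in> selfadjoint_ops \<Longrightarrow> K + s *\<^sub>R v \<in> selfadjoint_ops"
  using subspace_selfadjoint_ops by (simp add: subspace_add subspace_scale)

text \<open>The identity is a global chart.\<close>

lemma closed_subspace_submanifold:
  assumes "subspace E" "closed E"
  shows "submanifold E"
  unfolding submanifold_def
proof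
  fix K assume "K \<in> E"
  have "smooth_on UNIV (\<lambda>x :: hs. x)"
    by (intro smooth_on_bounded_linear bounded_linear_ident) auto
  then show "\<exists>U V \<phi> \<psi> E'. open U \<and> K \<in> U \<and> open V \<and>
     smooth_on U \<phi> \<and> smooth_on V \<psi> \<and> \<phi> ` U = V \<and> \<psi> ` V = U \<and>
     (\<forall>x\<in>U. \<psi> (\<phi> x) = x) \<and> (\<forall>y\<in>V. \<phi> (\<psi> y) = y) \<and>
     subspace E' \<and> closed (E' :: hs set) \<and> \<phi> ` (E \<inter> U) = E' \<inter> V"
    using assms by (intro exI[of _ UNIV] exI[of _ "\<lambda>x. x"] exI[of _ E]) auto
qed

lemma closed_selfadjoint_ops: "closed selfadjoint_ops"
proof -
  have "selfadjoint_ops = {K. hs_transpose K = K}" by (auto simp: selfadjoint_ops_iff)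
  moreover have "closed {K. hs_transpose K = K}"
    by (intro closed_Collect_eq continuous_intros linear_continuous_on bounded_linear_hs_transpose)
  ultimately show ?thesis by simp
qed

text \<open>The selfadjoint operators form a linear subspace, so straight lines realize all its
  elements as velocities.\<close>

lemma selfadjoint_tangent:
  assumes "K \<in> selfadjoint_ops" "v \<in> selfadjoint_ops"
  shows "v \<in> tangent_space selfadjoint_ops K"
proof -
  have "smooth_on {-1<..<1::real} (\<lambda>s. K + s *\<^sub>R v)"
    by (intro smooth_on_add smooth_on_const smooth_on_bounded_linear bounded_linear_scaleR_left) auto
  then show ?thesis
    unfolding tangent_space_def
    using assms line_in_selfadjoint_ops has_vector_derivative_line
    by (intro CollectI exI[of _ "\<lambda>s. K + s *\<^sub>R v"] exI[of _ 1]) auto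
qed

lemma poisson_submanifold_selfadjoint_ops: "poisson_submanifold selfadjoint_ops"
  unfolding poisson_submanifold_def
  by (simp add: closed_subspace_submanifold subspace_selfadjoint_ops closed_selfadjoint_ops
      hamiltonian_vf_eq selfadjoint_tangent ham_vec_selfadjoint)

section \<open>The induced Poisson structure\<close>

lemma local_extension_differentiable:
  "local_extension S f K F \<Longrightarrow> F differentiable (at K)"
  by (auto simp: local_extension_def intro: smooth_on_differentiable)

text \<open>A curve in \<open>S\<close> cannot tell a function on \<open>S\<close> from its extension, so the derivative along
  it is given by the gradient of any extension.\<close>

lemma local_extension_curve:
  assumes F: "local_extension S f (c t) F" and c: "\<And>s. c s \<in> S" "(c has_vector_derivative v) (at t)"
  shows "((\<lambda>s. f (c s)) has_real_derivative hs_pairing (grad F (c t)) v) (at t)"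
proof -
  obtain U where U: "open U" "c t \<in> U" "\<forall>x\<in>S \<inter> U. F x = f x"
    using F by (auto simp: local_extension_def)
  have "isCont c t" using c(2) has_vector_derivative_continuous by blast
  then have "\<forall>\<^sub>F s in at t. c s \<in> U"
    using U by (auto simp: isCont_def dest: topological_tendstoD)
  then have "\<forall>\<^sub>F s in at t. F (c s) = f (c s)"
    by eventually_elim (use U c in auto)
  then show ?thesis
    using has_real_derivative_along_curve[OF local_extension_differentiable[OF F] c(2)] U c
    by (subst has_field_derivative_cong_eventually[symmetric]) auto
qed

text \<open>All Hamiltonian velocities at selfadjoint operators are tangent to the selfadjoint operators,
  so the bracket sees only the restriction of its first argument, and by antisymmetry only that of
  its second.\<close>

lemma poisson_R_local_extension:
  assumes K: "K \<in> selfadjoint_ops"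
    and F: "local_extension selfadjoint_ops f K F" "local_extension selfadjoint_ops f K F'"
    and G: "local_extension selfadjoint_ops g K G" "local_extension selfadjoint_ops g K G'"
  shows "poisson_R F G K = poisson_R F' G' K"
proof -
  have first: "poisson_R F H K = poisson_R F' H K"
    if F: "local_extension selfadjoint_ops f K F" "local_extension selfadjoint_ops f K F'"
    for f F F' H
  proof -
    let ?v = "ham_vec (grad H K) K"
    let ?c = "\<lambda>s. K + s *\<^sub>R ?v"
    have c: "?c s \<in> selfadjoint_ops" "(?c has_vector_derivative ?v) (at 0)" for s
      using K by (auto intro!: line_in_selfadjoint_ops ham_vec_selfadjoint has_vector_derivative_line)
    show ?thesis
      using DERIV_unique[OF local_extension_curve[of selfadjoint_ops f ?c 0 F, OF _ c]
          local_extension_curve[of selfadjoint_ops f ?c 0 F', OF _ c]] F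
      by (simp add: poisson_R_eq)
  qed
  show ?thesis
    using first[OF F] first[OF G] poisson_R_anti by metis
qed

lemma induced_poisson_eq:
  assumes "K \<in> selfadjoint_ops" "local_extension selfadjoint_ops f K F"
    "local_extension selfadjoint_ops g K G"
  shows "induced_poisson selfadjoint_ops f g K = poisson_R F G K"
  unfolding induced_poisson_def
proof (rule the_equality)
  show "\<forall>F1 F2. local_extension selfadjoint_ops f K F1 \<longrightarrow>
      local_extension selfadjoint_ops g K F2 \<longrightarrow> poisson_R F1 F2 K = poisson_R F G K"
    using poisson_R_local_extension[OF assms(1)] assms by blast
qed (use assms in blast)

lemma smooth_local_extension: "smooth_on UNIV H \<Longrightarrow> local_extension S H K H"
  unfolding local_extension_def by (intro exI[of _ UNIV]) auto

text \<open>Restricting a globally smooth Hamiltonian to the Poisson submanifold restricts its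
  Hamiltonian vector field.\<close>

lemma hamiltonian_on_selfadjoint_ops:
  assumes H: "smooth_on UNIV H"
    and V: "\<And>K. K \<in> selfadjoint_ops \<Longrightarrow> V K = ham_vec (grad H K) K"
  shows "hamiltonian_on selfadjoint_ops H V"
  unfolding hamiltonian_on_def
proof (intro conjI ballI allI impI)
  show "smooth_on_submanifold selfadjoint_ops H"
    unfolding smooth_on_submanifold_def using smooth_local_extension[OF H] by blast
  show "V K \<in> tangent_space selfadjoint_ops K" if "K \<in> selfadjoint_ops" for K
    using that by (simp add: V selfadjoint_tangent ham_vec_selfadjoint)
  fix f c t
  assume f: "smooth_on_submanifold selfadjoint_ops f" and c: "\<forall>s. c s \<in> selfadjoint_ops"
    "(c has_vector_derivative V (c t)) (at t)"
  then obtain F where F: "local_extension selfadjoint_ops f (c t) F"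
    unfolding smooth_on_submanifold_def by blast
  show "((\<lambda>s. f (c s)) has_real_derivative induced_poisson selfadjoint_ops f H (c t)) (at t)"
    using local_extension_curve[of selfadjoint_ops f c t F, OF F] c
      induced_poisson_eq[OF _ F smooth_local_extension[OF H]]
    by (simp add: V poisson_R_eq)
qed

section \<open>Trace Hamiltonians\<close>

lemma hs_power_1: "hs_power K (Suc 0) = K"
  by (simp add: hs_power_def)

lemma hs_power_Suc_Suc: "hs_power K (Suc (Suc m)) = K \<odot> hs_power K (Suc m)"
  by (simp add: hs_power_def)

lemma hs_power_comp: "hs_power K (Suc i) \<odot> hs_power K (Suc m) = hs_power K (Suc (Suc (i + m)))"
  by (induction i) (simp_all add: hs_power_1 hs_power_Suc_Suc hs_comp_assoc)

lemma smooth_on_hs_power: "smooth_on UNIV (\<lambda>K. hs_power K (Suc m))"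
proof (induction m)
  case 0
  then show ?case by (simp add: hs_power_1 smooth_on_bounded_linear bounded_linear_ident)
next
  case (Suc m)
  then show ?case
    unfolding hs_power_Suc_Suc
    by (intro smooth_on_bilinear[OF _ bounded_bilinear_comp]
        smooth_on_bounded_linear[OF _ bounded_linear_ident]) auto
qed

text \<open>By cyclicity of the pairing, each of the \<open>m + 1\<close> terms of the product rule contributes the
  same amount. The power \<open>K ^ (i + 1)\<close> in front takes up the factors \<open>K\<close> that the product rule
  leaves to the left of the derivative.\<close>

lemma hs_power_has_derivative:
  "\<exists>D. ((\<lambda>K. hs_power K (Suc m)) has_derivative D) (at K) \<and>
    (\<forall>i K'. hs_pairing (hs_power K (Suc i)) (D K') =
      (real m + 1) * hs_pairing (hs_power K (Suc (i + m))) K')"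
proof (induction m)
  case 0
  then show ?case by (intro exI[of _ "\<lambda>x. x"]) (auto simp: hs_power_1)
next
  case (Suc m)
  then obtain D where D: "((\<lambda>K. hs_power K (Suc m)) has_derivative D) (at K)"
    "\<And>i K'. hs_pairing (hs_power K (Suc i)) (D K') =
      (real m + 1) * hs_pairing (hs_power K (Suc (i + m))) K'" by blast
  have "((\<lambda>K. K \<odot> hs_power K (Suc m)) has_derivative
      (\<lambda>K'. K \<odot> D K' + K' \<odot> hs_power K (Suc m))) (at K)"
    by (rule comp.FDERIV[OF has_derivative_ident D(1)])
  moreover have "hs_pairing (hs_power K (Suc i)) (K \<odot> D K' + K' \<odot> hs_power K (Suc m))
      = (real (Suc m) + 1) * hs_pairing (hs_power K (Suc (i + Suc m))) K'" for i K'
  proof -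
    have "hs_pairing (hs_power K (Suc i)) (K \<odot> D K') = hs_pairing (hs_power K (Suc (Suc i))) (D K')"
      using hs_power_comp[of K i 0] by (simp add: pairing_comp_assoc[symmetric] hs_power_1)
    moreover have "hs_pairing (hs_power K (Suc i)) (K' \<odot> hs_power K (Suc m))
        = hs_pairing (hs_power K (Suc m) \<odot> hs_power K (Suc i)) K'"
      by (metis pairing_commute pairing_comp_assoc)
    ultimately show ?thesis
      by (simp add: pairing.add_right D(2) hs_power_comp add.commute[of m i] algebra_simps)
  qed
  ultimately show ?case unfolding hs_power_Suc_Suc[of _ m] by blast
qed

text \<open>As a product of two Hilbert-Schmidt operators the power \<open>K ^ (m + 2)\<close> is of trace class, and
  its trace is a value of the pairing, hence a continuous polynomial in \<open>K\<close>.\<close>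

lemma trace_hamiltonian_eq:
  "trace_hamiltonian (Suc m) K = hs_pairing K (hs_power K (Suc m)) / (2 * (real m + 2))"
  by (simp add: trace_hamiltonian_def hs_power_Suc_Suc hs_trace_comp add.commute)

lemma smooth_on_trace_hamiltonian: "smooth_on UNIV (trace_hamiltonian (Suc m))"
proof -
  have "smooth_on UNIV (\<lambda>K :: hs. K)"
    by (rule smooth_on_bounded_linear[OF open_UNIV bounded_linear_ident])
  from smooth_on_bilinear[OF open_UNIV bounded_bilinear_mult
      smooth_on_const[OF open_UNIV, of "1 / (2 * (real m + 2))"]
      smooth_on_bilinear[OF open_UNIV bounded_bilinear_pairing this smooth_on_hs_power]]
  have "smooth_on UNIV (\<lambda>K. (1 / (2 * (real m + 2))) * hs_pairing K (hs_power K (Suc m)))" .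
  then show ?thesis
    by (simp add: trace_hamiltonian_eq[abs_def])
qed

lemma grad_trace_hamiltonian:
  "grad (trace_hamiltonian (Suc m)) K = (1/2) *\<^sub>R hs_power K (Suc m)"
proof (rule grad_eqI)
  obtain D where D: "((\<lambda>K. hs_power K (Suc m)) has_derivative D) (at K)"
    "\<And>i K'. hs_pairing (hs_power K (Suc i)) (D K') =
      (real m + 1) * hs_pairing (hs_power K (Suc (i + m))) K'"
    using hs_power_has_derivative by blast
  have "((\<lambda>K. hs_pairing K (hs_power K (Suc m)) / (2 * (real m + 2))) has_derivative
      (\<lambda>K'. (hs_pairing K (D K') + hs_pairing K' (hs_power K (Suc m))) / (2 * (real m + 2)))) (at K)"
    by (rule bounded_linear.has_derivative[OF bounded_linear_divide
        pairing.FDERIV[OF has_derivative_ident D(1)]])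
  moreover have "(hs_pairing K (D K') + hs_pairing K' (hs_power K (Suc m))) / (2 * (real m + 2))
      = hs_pairing ((1/2) *\<^sub>R hs_power K (Suc m)) K'" for K'
  proof -
    have "hs_pairing K (D K') + hs_pairing K' (hs_power K (Suc m))
        = (real m + 2) * hs_pairing (hs_power K (Suc m)) K'"
      using D(2)[of 0 K'] by (simp add: hs_power_1 pairing_commute[of K'] algebra_simps)
    moreover have "real m + 2 \<noteq> 0" by linarith
    ultimately show ?thesis by (simp add: pairing.scaleR_left field_simps)
  qed
  ultimately show "(trace_hamiltonian (Suc m) has_derivative
      hs_pairing ((1/2) *\<^sub>R hs_power K (Suc m))) (at K)"
    by (simp add: trace_hamiltonian_eq[abs_def])
qed

lemma lie_hs_power: "lie (hs_power K (Suc m)) K = 0"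
  using hs_power_comp[of K m 0] hs_power_comp[of K 0 m] by (simp add: lie_def hs_power_1)

lemma hamiltonian_on_trace_hamiltonian:
  assumes "j \<ge> 1"
  shows "hamiltonian_on selfadjoint_ops (trace_hamiltonian j)
    (\<lambda>K. (1/2) *\<^sub>R lie (proj_volterra (hs_power K j)) K)"
proof -
  obtain m where "j = Suc m" using assms by (cases j) auto
  then show ?thesis
    by (auto intro!: hamiltonian_on_selfadjoint_ops smooth_on_trace_hamiltonian
        simp: grad_trace_hamiltonian ham_vec_commuting lie_hs_power)
qed

lemma hamiltonian_vf_quadratic:
  "hamiltonian_vf (\<lambda>K. 1/4 * hs_pairing K K) = (\<lambda>K. (1/2) *\<^sub>R lie (proj_volterra K) K)"
proof -
  have "(\<lambda>K. 1/4 * hs_pairing K K) = trace_hamiltonian (Suc 0)"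
    by (rule ext) (simp add: trace_hamiltonian_eq hs_power_1)
  then show ?thesis
    by (simp add: hamiltonian_vf_eq grad_trace_hamiltonian hs_power_1 ham_vec_commuting lie_def)
qed

section \<open>The kernel of the quadratic flow\<close>

text \<open>The right-hand side of the integro-differential equation for the kernel \<open>k\<close>.\<close>

definition flow_kernel :: "(real \<times> real \<Rightarrow> real) \<Rightarrow> real \<Rightarrow> real \<Rightarrow> real" where
  "flow_kernel k x y =
      1/2 * (LBINT z:{..x}. k (x, z) * k (z, y))
    - 1/2 * (LBINT z:{y..}. k (x, z) * k (z, y))
    + 1/2 * (LBINT z:{..x}. k (z, x) * k (z, y))
    - 1/2 * (LBINT z:{y..}. k (x, z) * k (y, z))"

lemma AE_integrable_product:
  assumes a: "square_integrable (a :: real \<times> real \<Rightarrow> real)" and b: "square_integrable (b :: real \<times> real \<Rightarrow> real)"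
  shows "AE (x, y) in lborel. integrable lborel (\<lambda>z. a (x, z) * b (z, y))"
  using AE_fst[OF square_integrable_section_fst(1)[OF a]] AE_snd[OF square_integrable_section_snd(1)[OF b]]
  by eventually_elim (auto intro: square_integrable_mult)

lemma integrable_set_integrable:
  fixes f :: "real \<Rightarrow> real"
  shows "integrable lborel f \<Longrightarrow> S \<in> sets borel \<Longrightarrow> set_integrable lborel S f"
  unfolding set_integrable_def using integrable_mult_indicator[of S lborel f] by simp

text \<open>The diagonal is a null set; the value chosen there is the one that comes out of the formula
  for the projection.\<close>

lemma represents_proj_volterra:
  assumes "represents k A"
  shows "represents (\<lambda>(x, y). if x < y then 0 else if y < x then k (x, y) + k (y, x) else k (x, y))
    (proj_volterra A)"
proof -
  have "represents (\<lambda>p. k p - (indicator {(x, y). x < y} p * k p -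
      (case p of (x, y) \<Rightarrow> indicator {(x, y). x < y} (y, x) * k (y, x)))) (proj_volterra A)"
    unfolding proj_volterra_eq proj_skew_eq
    by (intro represents_diff represents_hs_transpose represents_upper assms)
  moreover have "(\<lambda>p. k p - (indicator {(x, y). x < y} p * k p -
      (case p of (x, y) \<Rightarrow> indicator {(x, y). x < y} (y, x) * k (y, x))))
      = (\<lambda>(x, y). if x < y then 0 else if y < x then k (x, y) + k (y, x) else k (x, y))"
    by (auto simp: fun_eq_iff indicator_def)
  ultimately show ?thesis by simp
qed

text \<open>Multiplying from the left by a Volterra kernel cuts the integral over \<open>z\<close> down to \<open>z \<le> x\<close>,
  multiplying from the right to \<open>z \<ge> y\<close>. Each of the two integrals splits because
  \<open>proj_volterra\<close> has kernel \<open>k (x, y) + k (y, x)\<close> below the diagonal.\<close>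

lemma AE_flow_kernel:
  assumes k: "represents k A" and d: "represents d ((1/2) *\<^sub>R lie (proj_volterra A) A)"
  shows "AE (x, y) in lborel. d (x, y) = flow_kernel k x y"
proof -
  let ?l = "\<lambda>(x, y). if x < y then 0 else if y < x then k (x, y) + k (y, x) else k (x, y)"
  let ?v = "\<lambda>(x, y). 1/2 * ((\<integral>z. ?l (x, z) * k (z, y) \<partial>lborel) - (\<integral>z. k (x, z) * ?l (z, y) \<partial>lborel))"
  note l = represents_proj_volterra[OF k]
  have [measurable]: "k \<in> borel_measurable (borel \<Otimes>\<^sub>M borel)" "?l \<in> borel_measurable (borel \<Otimes>\<^sub>M borel)"
    using k l by (auto intro!: square_integrable_pairD dest: represents_square_integrable)
  note s = represents_square_integrable[OF k] 
  note s' = square_integrable_swap[OF s]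
  have v: "represents (\<lambda>p. 1/2 * ((case p of (x, y) \<Rightarrow> \<integral>z. ?l (x, z) * k (z, y) \<partial>lborel)
      - (case p of (x, y) \<Rightarrow> \<integral>z. k (x, z) * ?l (z, y) \<partial>lborel))) ((1/2) *\<^sub>R lie (proj_volterra A) A)"
    unfolding lie_def by (intro represents_scaleR represents_diff represents_comp k l)
  have "AE p in lborel. d p = ?v p"
    using represents_eq_iff[OF d v] by (simp add: case_prod_unfold)
  moreover have "AE (x, y) in lborel. integrable lborel (\<lambda>z. k (x, z) * k (z, y))"
    using AE_integrable_product[OF s s] .
  moreover have "AE (x, y) in lborel. integrable lborel (\<lambda>z. k (z, x) * k (z, y))"
    using AE_integrable_product[OF s' s] by simp
  moreover have "AE (x, y) in lborel. integrable lborel (\<lambda>z. k (x, z) * k (y, z))"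
    using AE_integrable_product[OF s s'] by simp
  ultimately show ?thesis
  proof eventually_elim
    case (elim p)
    obtain x y where p: "p = (x, y)" by (cases p)
    have i: "integrable lborel (\<lambda>z. k (x, z) * k (z, y))" "integrable lborel (\<lambda>z. k (z, x) * k (z, y))"
      "integrable lborel (\<lambda>z. k (x, z) * k (y, z))"
      using elim(2-4) by (simp_all add: p)
    have "(\<integral>z. ?l (x, z) * k (z, y) \<partial>lborel) = (LBINT z:{..x}. k (x, z) * k (z, y) + k (z, x) * k (z, y))"
      unfolding set_lebesgue_integral_def
    proof (rule integral_cong_AE)
      show "AE z in lborel. ?l (x, z) * k (z, y)
          = indicator {..x} z *\<^sub>R (k (x, z) * k (z, y) + k (z, x) * k (z, y))"
        using AE_lborel_singleton[of x] by eventually_elim (auto simp: indicator_def algebra_simps)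
    qed measurable
    also have "\<dots> = (LBINT z:{..x}. k (x, z) * k (z, y)) + (LBINT z:{..x}. k (z, x) * k (z, y))"
      using i by (intro set_integral_add integrable_set_integrable) auto
    finally have 1: "(\<integral>z. ?l (x, z) * k (z, y) \<partial>lborel)
        = (LBINT z:{..x}. k (x, z) * k (z, y)) + (LBINT z:{..x}. k (z, x) * k (z, y))" .
    have "(\<integral>z. k (x, z) * ?l (z, y) \<partial>lborel) = (LBINT z:{y..}. k (x, z) * k (z, y) + k (x, z) * k (y, z))"
      unfolding set_lebesgue_integral_def
    proof (rule integral_cong_AE)
      show "AE z in lborel. k (x, z) * ?l (z, y)
          = indicator {y..} z *\<^sub>R (k (x, z) * k (z, y) + k (x, z) * k (y, z))"
        using AE_lborel_singleton[of y] by eventually_elim (auto simp: indicator_def algebra_simps)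
    qed measurable
    also have "\<dots> = (LBINT z:{y..}. k (x, z) * k (z, y)) + (LBINT z:{y..}. k (x, z) * k (y, z))"
      using i by (intro set_integral_add integrable_set_integrable) auto
    finally have 2: "(\<integral>z. k (x, z) * ?l (z, y) \<partial>lborel)
        = (LBINT z:{y..}. k (x, z) * k (z, y)) + (LBINT z:{y..}. k (x, z) * k (y, z))" .
    have alg: "1/2 * ((a + b) - (c + e)) = 1/2 * a - 1/2 * c + 1/2 * b - 1/2 * e" for a b c e :: real
      by (simp add: field_simps)
    show ?case
      using elim(1) unfolding p flow_kernel_def prod.case 1[unfolded prod.case] 2[unfolded prod.case] alg .
  qed
qed

text \<open>Two operators with almost everywhere equal kernels coincide, so the velocity of \<open>c\<close> can be
  compared with the vector field on kernels.\<close>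

lemma evolves_by_iff_kernel_equation:
  assumes "\<And>t d. t \<in> T \<Longrightarrow> represents d (X (c t)) \<Longrightarrow> AE (x, y) in lborel. d (x, y) = G t x y"
  shows "evolves_by T X c \<longleftrightarrow> kernel_equation T c G"
proof
  assume "evolves_by T X c"
  then show "kernel_equation T c G"
    unfolding evolves_by_def kernel_equation_def using assms[OF _ represents_rep] represents_rep
    by blast
next
  assume K: "kernel_equation T c G"
  show "evolves_by T X c"
    unfolding evolves_by_def
  proof
    fix t assume t: "t \<in> T"
    then obtain D d where D: "(c has_vector_derivative D) (at t)" "represents d D"
      "AE (x, y) in lborel. d (x, y) = G t x y"
      using K by (auto simp: kernel_equation_def)
    obtain e where e: "represents e (X (c t))" using represents_rep by metis
    have "AE p in lborel. d p = e p"
      using D(3) assms[OF t e] by eventually_elim auto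
    then have "D = X (c t)" using represents_eq_iff[OF D(2) e] by simp
    then show "(c has_vector_derivative X (c t)) (at t)" using D(1) by simp
  qed
qed

lemma selfadjoint_kernel_symmetric:
  assumes "represents k A" "A \<in> selfadjoint_ops"
  shows "AE (x, y) in lborel. k (x, y) = k (y, x)"
  using represents_eq_iff[OF assms(1) represents_hs_transpose[OF assms(1)]] assms(2)
  by (simp add: selfadjoint_ops_iff case_prod_unfold)

lemma integral_half_lines:
  fixes f :: "real \<Rightarrow> real"
  assumes "integrable lborel f"
  shows "(LBINT z:{..x}. f z) + (LBINT z:{x..}. f z) = (\<integral>z. f z \<partial>lborel)"
proof -
  note [measurable] = borel_measurable_integrable[OF assms]
  have "(LBINT z:{..x}. f z) + (LBINT z:{x..}. f z)
      = (\<integral>z. indicator {..x} z *\<^sub>R f z + indicator {x..} z *\<^sub>R f z \<partial>lborel)"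
    unfolding set_lebesgue_integral_def
    using integrable_set_integrable[OF assms, of "{..x}"] integrable_set_integrable[OF assms, of "{x..}"]
    by (simp add: set_integrable_def)
  also have "\<dots> = (\<integral>z. f z \<partial>lborel)"
  proof (rule integral_cong_AE)
    show "AE z in lborel. indicator {..x} z *\<^sub>R f z + indicator {x..} z *\<^sub>R f z = f z"
      using AE_lborel_singleton[of x] by eventually_elim (auto simp: indicator_def)
  qed measurable
  finally show ?thesis .
qed

text \<open>By symmetry the four integrals become equal in pairs. The second identity adds and subtracts the
  integral over the whole line.\<close>

lemma AE_symmetric_flow_kernel:
  assumes k: "square_integrable (k :: real \<times> real \<Rightarrow> real)"
    and sym: "AE (x, y) in lborel. k (x, y) = k (y, x)"
  shows "AE (x, y) in lborel.
    flow_kernel k x y = (LBINT z:{..x}. k (x, z) * k (z, y)) - (LBINT z:{y..}. k (x, z) * k (z, y)) \<and>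
    (LBINT z:{..x}. k (x, z) * k (z, y)) - (LBINT z:{y..}. k (x, z) * k (z, y))
      = (LBINT z:{..y}. k (x, z) * k (z, y)) - (LBINT z:{x..}. k (x, z) * k (z, y))"
proof -
  note [measurable] = square_integrable_pairD[OF k]
  have "AE (x, y) in (lborel :: (real \<times> real) measure). AE z in lborel. k (x, z) = k (z, x)"
    using AE_fst[OF AE_section_fst[OF sym]] by simp
  moreover have "AE (x, y) in (lborel :: (real \<times> real) measure). AE z in lborel. k (z, y) = k (y, z)"
    using AE_snd[OF AE_section_snd[OF sym]] by simp
  moreover have "AE (x, y) in lborel. integrable lborel (\<lambda>z. k (x, z) * k (z, y))"
    using AE_integrable_product[OF k k] .
  ultimately show ?thesis
  proof eventually_elim
    case (elim p)
    obtain x y where p: "p = (x, y)" by (cases p)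
    have "(LBINT z:{..x}. k (z, x) * k (z, y)) = (LBINT z:{..x}. k (x, z) * k (z, y))"
      unfolding set_lebesgue_integral_def
      by (rule integral_cong_AE, measurable) (use elim(1) in \<open>auto simp: p elim: eventually_mono\<close>)
    moreover have "(LBINT z:{y..}. k (x, z) * k (y, z)) = (LBINT z:{y..}. k (x, z) * k (z, y))"
      unfolding set_lebesgue_integral_def
      by (rule integral_cong_AE, measurable) (use elim(2) in \<open>auto simp: p elim: eventually_mono\<close>)
    ultimately show ?case
      using integral_half_lines[of "\<lambda>z. k (x, z) * k (z, y)" x]
        integral_half_lines[of "\<lambda>z. k (x, z) * k (z, y)" y] elim(3)
      by (simp add: p flow_kernel_def)
  qed
qed

theorem corollary2p5:
  shows "poisson_submanifold selfadjoint_ops \<and>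
    (\<forall>j\<ge>1. hamiltonian_on selfadjoint_ops (trace_hamiltonian j)
       (\<lambda>K. (1/2) *\<^sub>R lie (proj_volterra (hs_power K j)) K)) \<and>
    (\<forall>(c :: real \<Rightarrow> hs) (k :: real \<Rightarrow> real \<times> real \<Rightarrow> real) (T :: real set).
       (\<forall>t\<in>T. represents (k t) (c t)) \<longrightarrow>
       (evolves_by T (hamiltonian_vf (\<lambda>K. 1/4 * hs_pairing K K)) c \<longleftrightarrow>
        kernel_equation T c (\<lambda>t x y.
            1/2 * (LBINT z:{..x}. k t (x, z) * k t (z, y))
          - 1/2 * (LBINT z:{y..}. k t (x, z) * k t (z, y))
          + 1/2 * (LBINT z:{..x}. k t (z, x) * k t (z, y))
          - 1/2 * (LBINT z:{y..}. k t (x, z) * k t (y, z))))) \<and>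
    (\<forall>(c :: real \<Rightarrow> hs) (k :: real \<Rightarrow> real \<times> real \<Rightarrow> real) (T :: real set).
       (\<forall>t\<in>T. represents (k t) (c t) \<and> c t \<in> selfadjoint_ops) \<longrightarrow>
       (\<forall>t\<in>T. AE (x, y) in lborel. k t (x, y) = k t (y, x)) \<and>
       (\<forall>t\<in>T. AE (x, y) in lborel.
            1/2 * (LBINT z:{..x}. k t (x, z) * k t (z, y))
          - 1/2 * (LBINT z:{y..}. k t (x, z) * k t (z, y))
          + 1/2 * (LBINT z:{..x}. k t (z, x) * k t (z, y))
          - 1/2 * (LBINT z:{y..}. k t (x, z) * k t (y, z))
          = (LBINT z:{..x}. k t (x, z) * k t (z, y)) - (LBINT z:{y..}. k t (x, z) * k t (z, y)) \<and>
            (LBINT z:{..x}. k t (x, z) * k t (z, y)) - (LBINT z:{y..}. k t (x, z) * k t (z, y))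
          = (LBINT z:{..y}. k t (x, z) * k t (z, y)) - (LBINT z:{x..}. k t (x, z) * k t (z, y))) \<and>
       (evolves_by T (hamiltonian_vf (\<lambda>K. 1/4 * hs_pairing K K)) c \<longleftrightarrow>
        kernel_equation T c (\<lambda>t x y.
            (LBINT z:{..x}. k t (x, z) * k t (z, y)) - (LBINT z:{y..}. k t (x, z) * k t (z, y)))) \<and>
       (evolves_by T (hamiltonian_vf (\<lambda>K. 1/4 * hs_pairing K K)) c \<longleftrightarrow>
        kernel_equation T c (\<lambda>t x y.
            (LBINT z:{..y}. k t (x, z) * k t (z, y)) - (LBINT z:{x..}. k t (x, z) * k t (z, y)))))"
proof (intro conjI allI impI)
  show "poisson_submanifold selfadjoint_ops" by (rule poisson_submanifold_selfadjoint_ops)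
  show "hamiltonian_on selfadjoint_ops (trace_hamiltonian j)
      (\<lambda>K. (1/2) *\<^sub>R lie (proj_volterra (hs_power K j)) K)" if "1 \<le> j" for j
    using that by (rule hamiltonian_on_trace_hamiltonian)
next
  fix c :: "real \<Rightarrow> hs" and k :: "real \<Rightarrow> real \<times> real \<Rightarrow> real" and T :: "real set"
  assume k: "\<forall>t\<in>T. represents (k t) (c t)"
  show "evolves_by T (hamiltonian_vf (\<lambda>K. 1/4 * hs_pairing K K)) c \<longleftrightarrow>
      kernel_equation T c (\<lambda>t x y.
          1/2 * (LBINT z:{..x}. k t (x, z) * k t (z, y))
        - 1/2 * (LBINT z:{y..}. k t (x, z) * k t (z, y))
        + 1/2 * (LBINT z:{..x}. k t (z, x) * k t (z, y))
        - 1/2 * (LBINT z:{y..}. k t (x, z) * k t (y, z)))"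
    unfolding hamiltonian_vf_quadratic flow_kernel_def[symmetric]
    using k by (intro evolves_by_iff_kernel_equation AE_flow_kernel) auto
next
  fix c :: "real \<Rightarrow> hs" and k :: "real \<Rightarrow> real \<times> real \<Rightarrow> real" and T :: "real set"
  assume k: "\<forall>t\<in>T. represents (k t) (c t) \<and> c t \<in> selfadjoint_ops"
  have sym: "AE (x, y) in lborel. k t (x, y) = k t (y, x)" if "t \<in> T" for t
    using k that selfadjoint_kernel_symmetric by blast
  have flow: "AE (x, y) in lborel. d (x, y) = flow_kernel (k t) x y"
    if "t \<in> T" "represents d (hamiltonian_vf (\<lambda>K. 1/4 * hs_pairing K K) (c t))" for t d
    using k that unfolding hamiltonian_vf_quadratic by (intro AE_flow_kernel) auto
  have red: "AE (x, y) in lborel.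
      flow_kernel (k t) x y
        = (LBINT z:{..x}. k t (x, z) * k t (z, y)) - (LBINT z:{y..}. k t (x, z) * k t (z, y)) \<and>
      (LBINT z:{..x}. k t (x, z) * k t (z, y)) - (LBINT z:{y..}. k t (x, z) * k t (z, y))
        = (LBINT z:{..y}. k t (x, z) * k t (z, y)) - (LBINT z:{x..}. k t (x, z) * k t (z, y))"
    if "t \<in> T" for t
    using k that sym by (intro AE_symmetric_flow_kernel represents_square_integrable) auto
  show "\<forall>t\<in>T. AE (x, y) in lborel. k t (x, y) = k t (y, x)" using sym by blast
  show "\<forall>t\<in>T. AE (x, y) in lborel.
      1/2 * (LBINT z:{..x}. k t (x, z) * k t (z, y))
    - 1/2 * (LBINT z:{y..}. k t (x, z) * k t (z, y))
    + 1/2 * (LBINT z:{..x}. k t (z, x) * k t (z, y))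
    - 1/2 * (LBINT z:{y..}. k t (x, z) * k t (y, z))
    = (LBINT z:{..x}. k t (x, z) * k t (z, y)) - (LBINT z:{y..}. k t (x, z) * k t (z, y)) \<and>
      (LBINT z:{..x}. k t (x, z) * k t (z, y)) - (LBINT z:{y..}. k t (x, z) * k t (z, y))
    = (LBINT z:{..y}. k t (x, z) * k t (z, y)) - (LBINT z:{x..}. k t (x, z) * k t (z, y))"
    unfolding flow_kernel_def[symmetric] using red by blast
  show "evolves_by T (hamiltonian_vf (\<lambda>K. 1/4 * hs_pairing K K)) c \<longleftrightarrow>
      kernel_equation T c (\<lambda>t x y.
        (LBINT z:{..x}. k t (x, z) * k t (z, y)) - (LBINT z:{y..}. k t (x, z) * k t (z, y)))"
  proof (rule evolves_by_iff_kernel_equation)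
    fix t d assume td: "t \<in> T" "represents d (hamiltonian_vf (\<lambda>K. 1/4 * hs_pairing K K) (c t))"
    show "AE (x, y) in lborel. d (x, y) =
        (LBINT z:{..x}. k t (x, z) * k t (z, y)) - (LBINT z:{y..}. k t (x, z) * k t (z, y))"
      using flow[OF td] red[OF td(1)] by eventually_elim auto
  qed
  show "evolves_by T (hamiltonian_vf (\<lambda>K. 1/4 * hs_pairing K K)) c \<longleftrightarrow>
      kernel_equation T c (\<lambda>t x y.
        (LBINT z:{..y}. k t (x, z) * k t (z, y)) - (LBINT z:{x..}. k t (x, z) * k t (z, y)))"
  proof (rule evolves_by_iff_kernel_equation)
    fix t d assume td: "t \<in> T" "represents d (hamiltonian_vf (\<lambda>K. 1/4 * hs_pairing K K) (c t))"
    show "AE (x, y) in lborel. d (x, y) =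
        (LBINT z:{..y}. k t (x, z) * k t (z, y)) - (LBINT z:{x..}. k t (x, z) * k t (z, y))"
      using flow[OF td] red[OF td(1)] by eventually_elim auto
  qed
qed

end
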